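(* \textsc{Colored Clustering} can be solved in $\mathcal{O}^*(2^{\mathcal{O}(k)})$ time, where $k$ is the required number of stable edges.
   Context: \textsc{Colored Clustering}: given a graph $G=(V,E)$, an edge coloring $\ell\colon E\to C$ (where $C$ is a finite set of colors) and an integer $k\in\mathbb{N}$, decide whether $G$ contains a stable edge set $F\subseteq E$ with $|F|\ge k$. A set $F\subseteq E$ is stable if $\ell(e)=\ell(e')$ for all $e,e'\in F$ with $e\cap e'\neq\emptyset$. The notation $\mathcal{O}^*$ hides factors polynomial in the input size. *)

theory Defs
  imports
    Complex_Main
    "HOL-Library.Landau_Symbols"
    "HOL-Library.Log_Nat"
    "HOL-Computational_Algebra.Polynomial"
begin

section \<open>The decision problem\<close>

definition simple_graph :: "'v set \<Rightarrow> 'v set set \<Rightarrow> bool" where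
  "simple_graph V E \<longleftrightarrow> finite V \<and> (\<forall>e\<in>E. e \<subseteq> V \<and> card e = 2)"

definition edge_coloring :: "'v set set \<Rightarrow> 'c set \<Rightarrow> ('v set \<Rightarrow> 'c) \<Rightarrow> bool" where
  "edge_coloring E C l \<longleftrightarrow> finite C \<and> (\<forall>e\<in>E. l e \<in> C)"

definition stable :: "('v set \<Rightarrow> 'c) \<Rightarrow> 'v set set \<Rightarrow> bool" where
  "stable l F \<longleftrightarrow> (\<forall>e\<in>F. \<forall>e'\<in>F. e \<inter> e' \<noteq> {} \<longrightarrow> l e = l e')"

definition colored_clustering :: "'v set set \<Rightarrow> ('v set \<Rightarrow> 'c) \<Rightarrow> nat \<Rightarrow> bool" where
  "colored_clustering E l k \<longleftrightarrow> (\<exists>F. F \<subseteq> E \<and> stable l F \<and> card F \<ge> k)"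

section \<open>Random access machines\<close>

text \<open>
  The model is a RAM with unit costs whose only arithmetic operations are addition and
  truncated subtraction, programmed with structured control flow instead of jumps.
  A program uses finitely many registers and finitely many infinite arrays, the latter with
  computed indices. There is no multiplication, so a number can at most double in a single step
  and hence after \<open>t\<close> steps all numbers have at most \<open>t\<close> bits more than the largest
  number among the input words and the constants of the program. Therefore the running time
  agrees, up to a polynomial in the running time and the input size, with that of
  (multi-tape) Turing machines; compare Cook and Reckhow, "Time bounded random access machines".
\<close>

datatype aexp =
    Const nat
  | Var string
  | Cell string aexp
  | Add aexp aexp
  | Sub aexp aexp

datatype bexp =
    Lt aexp aexp
  | Neg bexp
  | Conj bexp bexp

datatype com =
    Skip
  | Assign string aexp
  | Store string aexp aexp  \<comment> \<open>array, index, new value\<close>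
  | Seq com com
  | Cond bexp com com
  | While bexp com

record state =
  reg :: "string \<Rightarrow> nat"
  mem :: "string \<Rightarrow> nat \<Rightarrow> nat"

fun aval :: "aexp \<Rightarrow> state \<Rightarrow> nat" where
  "aval (Const n) s = n"
| "aval (Var x) s = reg s x"
| "aval (Cell x a) s = mem s x (aval a s)"
| "aval (Add a b) s = aval a s + aval b s"
| "aval (Sub a b) s = aval a s - aval b s"

fun acost :: "aexp \<Rightarrow> nat" where
  "acost (Const n) = 1"
| "acost (Var x) = 1"
| "acost (Cell x a) = 1 + acost a"
| "acost (Add a b) = 1 + acost a + acost b"
| "acost (Sub a b) = 1 + acost a + acost b"

fun bval :: "bexp \<Rightarrow> state \<Rightarrow> bool" where
  "bval (Lt a b) s \<longleftrightarrow> aval a s < aval b s"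
| "bval (Neg p) s \<longleftrightarrow> \<not> bval p s"
| "bval (Conj p q) s \<longleftrightarrow> bval p s \<and> bval q s"

fun bcost :: "bexp \<Rightarrow> nat" where
  "bcost (Lt a b) = 1 + acost a + acost b"
| "bcost (Neg p) = 1 + bcost p"
| "bcost (Conj p q) = 1 + bcost p + bcost q"

text \<open>\<open>exec c s t s'\<close>: started in state \<open>s\<close>, the program \<open>c\<close> halts after
  \<open>t\<close> steps in state \<open>s'\<close>.\<close>

inductive exec :: "com \<Rightarrow> state \<Rightarrow> nat \<Rightarrow> state \<Rightarrow> bool" where
  Skip: "exec Skip s 1 s"
| Assign: "exec (Assign x a) s (1 + acost a) (s\<lparr>reg := (reg s)(x := aval a s)\<rparr>)"
| Store: "exec (Store x i a) s (1 + acost i + acost a)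
    (s\<lparr>mem := (mem s)(x := (mem s x)(aval i s := aval a s))\<rparr>)"
| Seq: "exec c s t s' \<Longrightarrow> exec d s' u s'' \<Longrightarrow> exec (Seq c d) s (t + u) s''"
| CondTrue: "bval b s \<Longrightarrow> exec c s t s' \<Longrightarrow> exec (Cond b c d) s (1 + bcost b + t) s'"
| CondFalse: "\<not> bval b s \<Longrightarrow> exec d s t s' \<Longrightarrow> exec (Cond b c d) s (1 + bcost b + t) s'"
| WhileFalse: "\<not> bval b s \<Longrightarrow> exec (While b c) s (1 + bcost b) s"
| WhileTrue: "bval b s \<Longrightarrow> exec c s t s' \<Longrightarrow> exec (While b c) s' u s'' \<Longrightarrow>
    exec (While b c) s (1 + bcost b + t + u) s''"

lemma exec_deterministic:
  assumes "exec c s t s'" and "exec c s u s''"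
  shows "t = u \<and> s' = s''"
  using assms
proof (induction arbitrary: u s'' rule: exec.induct)
  case (Skip s)
  then show ?case by cases auto
next
  case (Assign x a s)
  then show ?case by cases auto
next
  case (Store x i a s)
  then show ?case by cases auto
next
  case (Seq c s t s' d v r)
  from Seq.prems show ?case by cases (use Seq.IH in blast)
next
  case (CondTrue b s c t s' d)
  from CondTrue.prems show ?case by cases (use CondTrue in blast)+
next
  case (CondFalse b s d t s' c)
  from CondFalse.prems show ?case by cases (use CondFalse in blast)+
next
  case (WhileFalse b s c)
  from WhileFalse.prems show ?case by cases (use WhileFalse in blast)+
next
  case (WhileTrue b s c t s' v r)
  from WhileTrue.prems show ?case by cases (use WhileTrue in blast)+
qed

definition initial_state :: "nat list \<Rightarrow> state" where
  "initial_state xs =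
    \<lparr>reg = (\<lambda>_. 0)(''len'' := length xs),
     mem = (\<lambda>_ _. 0)(''in'' := (\<lambda>i. if i < length xs then xs ! i else 0))\<rparr>"

definition decides_within :: "com \<Rightarrow> nat list \<Rightarrow> bool \<Rightarrow> nat \<Rightarrow> bool" where
  "decides_within P xs answer T \<longleftrightarrow>
    (\<exists>t s. exec P (initial_state xs) t s \<and> t \<le> T \<and> reg s ''out'' = (if answer then 1 else 0))"

section \<open>Instances as machine input\<close>

text \<open>
  Vertices and colors are numbered \<open>0, 1, \<dots>\<close> in an arbitrary order, and an edge is passed as
  the numbers of its two endpoints and of its color. The order of the edges and of the endpoints
  of an edge is arbitrary as well, so a single instance has several encodings.
\<close>

definition encodes ::
  "nat list \<Rightarrow> 'v set \<Rightarrow> 'v set set \<Rightarrow> 'c set \<Rightarrow> ('v set \<Rightarrow> 'c) \<Rightarrow> nat \<Rightarrow> bool" where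
  "encodes xs V E C l k \<longleftrightarrow>
    (\<exists>vs cs es.
      distinct vs \<and> set vs = V \<and> distinct cs \<and> set cs = C \<and>
      (\<forall>(i, j, c) \<in> set es. i < length vs \<and> j < length vs \<and> c < length cs \<and>
        l {vs ! i, vs ! j} = cs ! c) \<and>
      distinct (map (\<lambda>(i, j, c). {vs ! i, vs ! j}) es) \<and>
      set (map (\<lambda>(i, j, c). {vs ! i, vs ! j}) es) = E \<and>
      xs = [length vs, length cs, k, length es] @ concat (map (\<lambda>(i, j, c). [i, j, c]) es))"

lemma encodes_exists:
  fixes V :: "'v set" and C :: "'c set"
  assumes "simple_graph V E" and "edge_coloring E C l"
  shows "\<exists>xs. encodes xs V E C l k"
proof -
  from assms have fin: "finite V" "finite C" and E: "E \<subseteq> Pow V"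
    by (auto simp: simple_graph_def edge_coloring_def)
  obtain vs where vs: "set vs = V" "distinct vs" using finite_distinct_list[OF fin(1)] by blast
  obtain cs where cs: "set cs = C" "distinct cs" using finite_distinct_list[OF fin(2)] by blast
  have "finite E" using E fin(1) by (simp add: finite_subset)
  then obtain L where L: "set L = E" "distinct L" using finite_distinct_list by blast
  define ok where "ok e p \<longleftrightarrow> (case p of (i, j, c) \<Rightarrow>
      i < length vs \<and> j < length vs \<and> c < length cs \<and> l {vs ! i, vs ! j} = cs ! c)
      \<and> (\<lambda>(i, j, c). {vs ! i, vs ! j}) p = e" for e and p :: "nat \<times> nat \<times> nat"
  have "\<exists>p. ok e p" if e: "e \<in> set L" for e
  proof -
    from e L(1) assms(1) have "e \<subseteq> V" "card e = 2" by (auto simp: simple_graph_def)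
    then obtain x y where xy: "e = {x, y}" "x \<in> set vs" "y \<in> set vs"
      using vs(1) by (auto simp: card_2_iff)
    obtain i where i: "i < length vs" "vs ! i = x" using xy(2) by (auto simp: in_set_conv_nth)
    obtain j where j: "j < length vs" "vs ! j = y" using xy(3) by (auto simp: in_set_conv_nth)
    have "l e \<in> set cs" using e L(1) assms(2) cs(1) by (simp add: edge_coloring_def)
    then obtain c where c: "c < length cs" "cs ! c = l e" by (auto simp: in_set_conv_nth)
    have "ok e (i, j, c)" using i j c xy(1) by (simp add: ok_def)
    then show ?thesis ..
  qed
  then have "\<forall>e\<in>set L. \<exists>p. ok e p" by blast
  then obtain f where f: "\<forall>e\<in>set L. ok e (f e)" by (rule bchoice[THEN exE])
  have m: "map (\<lambda>(i, j, c). {vs ! i, vs ! j}) (map f L) = L"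
    unfolding map_map by (rule map_idI) (use f in \<open>simp add: ok_def\<close>)
  have g: "\<forall>(i, j, c) \<in> set (map f L). i < length vs \<and> j < length vs \<and> c < length cs \<and>
        l {vs ! i, vs ! j} = cs ! c"
    using f by (simp add: ok_def)
  have "encodes ([length vs, length cs, k, length (map f L)]
      @ concat (map (\<lambda>(i, j, c). [i, j, c]) (map f L))) V E C l k"
    unfolding encodes_def
    by (intro exI[of _ vs] exI[of _ cs] exI[of _ "map f L"] conjI vs cs g refl)
      (simp_all only: m L)
  then show ?thesis ..
qed

text \<open>The vertex set and the color set count with their cardinality, as they would if their
  elements were listed one by one; \<open>k\<close> counts with its number of binary digits.\<close>

definition input_size :: "'v set \<Rightarrow> 'v set set \<Rightarrow> 'c set \<Rightarrow> nat \<Rightarrow> nat" where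
  "input_size V E C k = card V + card E + card C + floorlog 2 k"

end

theory Submission
  imports Defs "HOL-Library.Nat_Bijection"
begin

text \<open>
  A solution may be assumed to have exactly \<open>k\<close> edges, hence at most \<open>2 k\<close> endpoints. If the vertices
  carry \<open>D = O(k)\<close> labels such that the endpoints of a solution get pairwise different labels, then
  the color classes of the solution occupy disjoint sets of labels, and since all edges of one color
  inside a set of labels can be taken together, the optimum over partitions of the label set is
  computed by the recursion \<open>F S = max {weight B + F (S - B) | {} \<noteq> B \<subseteq> S}\<close> in time \<open>4\<^sup>D\<close> up to
  polynomial factors. Any labeling yields a lower bound, so it remains to try a family of
  \<open>2\<^bsup>O(k)\<^esup>\<close> times polynomially many labelings that separates every set \<open>K\<close> of \<open>Q = 2 k\<close> vertices.

  For this, vertex \<open>v\<close> is hashed to the fraction \<open>(a v mod M) / M\<close> with \<open>M = (n + 1) 2\<^sup>D\<close>, and \<open>Q\<close>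
  equally long intervals give the initial labels. Averaging over \<open>a\<close> shows that for some \<open>a\<close> the pairs
  in \<open>K\<close> that share an interval agree on only \<open>O(k)\<close> further binary digits in total. Hence
  repeatedly halving the intervals that still contain two elements of \<open>K\<close> takes \<open>O(k)\<close> splits,
  and which intervals to split is described by a word of \<open>O(k)\<close> bits, all of which are tried.
\<close>

section \<open>Running times and correctness of programs\<close>

fun written_regs :: "com \<Rightarrow> string set" where
  "written_regs (Assign x a) = {x}"
| "written_regs (Seq c d) = written_regs c \<union> written_regs d"
| "written_regs (Cond b c d) = written_regs c \<union> written_regs d"
| "written_regs (While b c) = written_regs c"
| "written_regs _ = {}"

fun written_arrays :: "com \<Rightarrow> string set" where
  "written_arrays (Store x i a) = {x}"
| "written_arrays (Seq c d) = written_arrays c \<union> written_arrays d"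
| "written_arrays (Cond b c d) = written_arrays c \<union> written_arrays d"
| "written_arrays (While b c) = written_arrays c"
| "written_arrays _ = {}"

definition same_outside :: "com \<Rightarrow> state \<Rightarrow> state \<Rightarrow> bool" where
  "same_outside c s s' \<longleftrightarrow> (\<forall>x. x \<notin> written_regs c \<longrightarrow> reg s' x = reg s x) \<and>
    (\<forall>a. a \<notin> written_arrays c \<longrightarrow> mem s' a = mem s a)"

lemma same_outside_reg: "same_outside c s s' \<Longrightarrow> x \<notin> written_regs c \<Longrightarrow> reg s' x = reg s x"
  and same_outside_mem: "same_outside c s s' \<Longrightarrow> a \<notin> written_arrays c \<Longrightarrow> mem s' a = mem s a"
  by (auto simp: same_outside_def)

lemma exec_same_outside: "exec c s t s' \<Longrightarrow> same_outside c s s'"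
  by (induction rule: exec.induct) (auto simp: same_outside_def)

text \<open>A bound on the running time if no loop, each time it is started, makes more than \<open>X\<close> rounds.\<close>

fun steps :: "nat \<Rightarrow> com \<Rightarrow> nat" where
  "steps X Skip = 1"
| "steps X (Assign x a) = 1 + acost a"
| "steps X (Store x i a) = 1 + acost i + acost a"
| "steps X (Seq c d) = steps X c + steps X d"
| "steps X (Cond b c d) = 1 + bcost b + steps X c + steps X d"
| "steps X (While b c) = (X + 1) * (1 + bcost b + steps X c)"

text \<open>Every level of loop nesting contributes one factor \<open>X + 1\<close>. For a fixed
  program, a bound on all loop counts thus becomes a polynomial time bound.\<close>

lemma steps_poly: "\<exists>p :: nat poly. \<forall>X. steps X c = poly p X"
proof (induction c)
  case Skip
  show ?case by (intro exI[of _ "[:1:]"]) simp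
next
  case (Assign x a)
  show ?case by (intro exI[of _ "[:1 + acost a:]"]) simp
next
  case (Store x i a)
  show ?case by (intro exI[of _ "[:1 + acost i + acost a:]"]) simp
next
  case (Seq c d)
  then obtain p q where "\<forall>X. steps X c = poly p X" "\<forall>X. steps X d = poly q X" by blast
  then show ?case by (intro exI[of _ "p + q"]) simp
next
  case (Cond b c d)
  then obtain p q where "\<forall>X. steps X c = poly p X" "\<forall>X. steps X d = poly q X" by blast
  then show ?case by (intro exI[of _ "[:1 + bcost b:] + p + q"]) simp
next
  case (While b c)
  then obtain p where "\<forall>X. steps X c = poly p X" by blast
  then show ?case
    by (intro exI[of _ "[:1, 1:] * ([:1 + bcost b:] + p)"]) (simp add: algebra_simps)
qed

text \<open>Separates an exponential factor \<open>u\<close> from a factor \<open>v\<close> of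
  polynomial size: \<open>u ^ i \<le> u ^ degree p\<close> in every monomial since
  \<open>u \<ge> 1\<close>.\<close>

lemma poly_mult_le:
  fixes p :: "nat poly"
  assumes "u \<ge> 1"
  shows "poly p (u * v) \<le> u ^ degree p * poly p v"
proof -
  have "coeff p i * (u * v) ^ i \<le> u ^ degree p * (coeff p i * v ^ i)" if "i \<le> degree p" for i
  proof -
    have "u ^ i \<le> u ^ degree p" using assms that by (intro power_increasing)
    then have "u ^ i * (coeff p i * v ^ i) \<le> u ^ degree p * (coeff p i * v ^ i)"
      by (rule mult_le_mono1)
    then show ?thesis by (simp only: power_mult_distrib mult_ac)
  qed
  then show ?thesis
    unfolding poly_altdef sum_distrib_left by (intro sum_mono) simp
qed

text \<open>Total correctness together with the time bound \<open>steps X c\<close>. Execution is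
  deterministic, so the existential speaks of the only run.\<close>

definition runs :: "nat \<Rightarrow> com \<Rightarrow> state \<Rightarrow> (state \<Rightarrow> bool) \<Rightarrow> bool" where
  "runs X c s Q \<longleftrightarrow> (\<exists>t s'. exec c s t s' \<and> t \<le> steps X c \<and> Q s')"

lemma runs_Skip: "Q s \<Longrightarrow> runs X Skip s Q"
  unfolding runs_def using exec.Skip[of s] by auto

lemma runs_Assign: "Q (s\<lparr>reg := (reg s)(x := aval a s)\<rparr>) \<Longrightarrow> runs X (Assign x a) s Q"
  unfolding runs_def using exec.Assign[of x a s] by auto

lemma runs_Store:
  "Q (s\<lparr>mem := (mem s)(x := (mem s x)(aval i s := aval a s))\<rparr>) \<Longrightarrow> runs X (Store x i a) s Q"
  unfolding runs_def using exec.Store[of x i a s] by auto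

lemma runs_Seq: "runs X c s (\<lambda>s'. runs X d s' Q) \<Longrightarrow> runs X (Seq c d) s Q"
  unfolding runs_def steps.simps by (meson exec.Seq add_mono)

lemma runs_Cond:
  assumes "bval b s \<Longrightarrow> runs X c s Q" "\<not> bval b s \<Longrightarrow> runs X d s Q"
  shows "runs X (Cond b c d) s Q"
proof (cases "bval b s")
  case True
  then obtain t s' where "exec c s t s'" "t \<le> steps X c" "Q s'"
    using assms unfolding runs_def by blast
  with True show ?thesis unfolding runs_def
    using exec.CondTrue[of b s c t s' d] by (intro exI[of _ "1 + bcost b + t"] exI[of _ s']) simp
next
  case False
  then obtain t s' where "exec d s t s'" "t \<le> steps X d" "Q s'"
    using assms unfolding runs_def by blast
  with False show ?thesis unfolding runs_def
    using exec.CondFalse[of b s d t s' c] by (intro exI[of _ "1 + bcost b + t"] exI[of _ s']) simp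
qed

text \<open>Every run leaves alone what the program does not write, so a specification need only
  mention the changed parts; the rest is supplied by \<open>same_outside\<close>.\<close>

lemma runs_conseq:
  assumes "runs X c s P" "\<And>s'. P s' \<Longrightarrow> same_outside c s s' \<Longrightarrow> Q s'"
  shows "runs X c s Q"
  using assms exec_same_outside unfolding runs_def by blast

definition For :: "string \<Rightarrow> string \<Rightarrow> com \<Rightarrow> com" where
  "For x y c = Seq (Assign x (Const 0))
     (While (Lt (Var x) (Var y)) (Seq c (Assign x (Add (Var x) (Const 1)))))"

lemma written_For [simp]:
  "written_regs (For x y c) = insert x (written_regs c)"
  "written_arrays (For x y c) = written_arrays c"
  by (auto simp: For_def)

text \<open>\<open>Inv i\<close> holds when round \<open>i\<close> starts, with the counter already
  set to \<open>i\<close>. The bound is reread from \<open>y\<close> in every round, hence the body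
  must not write it.\<close>

lemma runs_For:
  assumes y: "reg s y = N" and "N \<le> X" "x \<noteq> y" "x \<notin> written_regs c" "y \<notin> written_regs c"
    and start: "Inv 0 (s\<lparr>reg := (reg s)(x := 0)\<rparr>)"
    and step: "\<And>i s'. i < N \<Longrightarrow> Inv i s' \<Longrightarrow> reg s' x = i \<Longrightarrow> same_outside (For x y c) s s' \<Longrightarrow>
      runs X c s' (\<lambda>s''. Inv (Suc i) (s''\<lparr>reg := (reg s'')(x := Suc i)\<rparr>))"
    and final: "\<And>s'. Inv N s' \<Longrightarrow> same_outside (For x y c) s s' \<Longrightarrow> Q s'"
  shows "runs X (For x y c) s Q"
proof -
  define body where "body = Seq c (Assign x (Add (Var x) (Const 1)))"
  define loop where "loop = While (Lt (Var x) (Var y)) body"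
  \<comment> \<open>Four steps for the test, then the body with its increment.\<close>
  define T where "T = 4 + steps X body"
  have so: "same_outside (For x y c) s s' \<longleftrightarrow> (\<forall>z. z \<notin> insert x (written_regs c) \<longrightarrow> reg s' z = reg s z)
      \<and> (\<forall>a. a \<notin> written_arrays c \<longrightarrow> mem s' a = mem s a)" for s'
    by (simp add: same_outside_def)
  have loop: "\<exists>t s''. exec loop s' t s'' \<and> t \<le> (N - i + 1) * T \<and> Inv N s'' \<and>
      same_outside (For x y c) s s''"
    if "i \<le> N" "Inv i s'" "reg s' x = i" "same_outside (For x y c) s s'" for i s'
    using that
  \<comment> \<open>Downward from \<open>N\<close>, since the time left at round \<open>i\<close>
    builds on that at round \<open>i + 1\<close>.\<close>
  proof (induction i arbitrary: s' rule: inc_induct)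
    case base
    have "reg s' y = N" using base y assms(3,5) by (simp add: so)
    then have "exec loop s' 4 s'"
      unfolding loop_def using exec.WhileFalse[of "Lt (Var x) (Var y)" s' body] base
      by (simp add: eval_nat_numeral)
    then show ?case using base by (intro exI[of _ 4] exI[of _ s']) (simp add: T_def)
  next
    case (step i)
    have y': "reg s' y = N" using step y assms(3,5) by (simp add: so)
    obtain t r where r: "exec c s' t r" "t \<le> steps X c"
        "Inv (Suc i) (r\<lparr>reg := (reg r)(x := Suc i)\<rparr>)"
      using assms(7) step unfolding runs_def by blast
    define r' where "r' = r\<lparr>reg := (reg r)(x := Suc i)\<rparr>"
    have fr: "same_outside c s' r" using r exec_same_outside by blast
    have "reg r x = i" using fr step assms(4) by (simp add: same_outside_def)
    then have "exec (Assign x (Add (Var x) (Const 1))) r 4 r'"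
      using exec.Assign[of x "Add (Var x) (Const 1)" r] by (simp add: r'_def eval_nat_numeral)
    then have body: "exec body s' (t + 4) r'"
      unfolding body_def using exec.Seq r by blast
    have "same_outside (For x y c) s r'"
      using fr step assms(4) by (auto simp: so same_outside_def r'_def)
    then obtain u s'' where u: "exec loop r' u s''" "u \<le> (N - Suc i + 1) * T" "Inv N s''"
        "same_outside (For x y c) s s''"
      using step.IH[of r'] r by (auto simp: r'_def)
    have "exec loop s' (1 + 3 + (t + 4) + u) s''"
      unfolding loop_def
      using exec.WhileTrue[of "Lt (Var x) (Var y)" s' body "t + 4" r' u s''] y' step body u
      by (simp add: loop_def eval_nat_numeral)
    moreover have "1 + 3 + (t + 4) + u \<le> (N - i + 1) * T"
    proof -
      have "N - i + 1 = Suc (N - Suc i + 1)" using step by simp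
      then show ?thesis using u r(2) by (simp add: T_def body_def)
    qed
    ultimately show ?case using u by blast
  qed
  obtain t s'' where t: "exec loop (s\<lparr>reg := (reg s)(x := 0)\<rparr>) t s''" "t \<le> (N + 1) * T" "Inv N s''"
      "same_outside (For x y c) s s''"
    using loop[of 0 "s\<lparr>reg := (reg s)(x := 0)\<rparr>"] start by (auto simp: so)
  have "exec (Assign x (Const 0)) s 2 (s\<lparr>reg := (reg s)(x := 0)\<rparr>)"
    using exec.Assign[of x "Const 0" s] by (simp add: eval_nat_numeral)
  then have "exec (For x y c) s (2 + t) s''"
    unfolding For_def using exec.Seq[OF _ t(1)] unfolding loop_def body_def by blast
  moreover have "2 + t \<le> steps X (For x y c)"
  proof -
    have "(N + 1) * T \<le> (X + 1) * T" using assms(2) by (intro mult_le_mono1) simp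
    moreover have "steps X (For x y c) = 2 + (X + 1) * T" by (simp add: For_def T_def body_def algebra_simps)
    ultimately show ?thesis using t(2) by linarith
  qed
  ultimately show ?thesis unfolding runs_def using final t by blast
qed

section \<open>Labelings that separate a small set of vertices\<close>

lemma card_spread:
  fixes A :: "nat set"
  assumes "finite A" "\<And>a b. a \<in> A \<Longrightarrow> b \<in> A \<Longrightarrow> b \<le> a \<Longrightarrow> d * (a - b) \<le> B"
  shows "d * card A \<le> B + d"
proof (cases "A = {}")
  case False
  then have M: "Max A \<in> A" "Min A \<in> A" using assms(1) by auto
  have "A \<subseteq> {Min A..Max A}" using assms(1) by auto
  then have "card A \<le> card {Min A..Max A}" by (intro card_mono) auto
  also have "\<dots> \<le> (Max A - Min A) + 1" by simp
  finally have "d * card A \<le> d * ((Max A - Min A) + 1)" by (rule mult_le_mono2)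
  also have "\<dots> \<le> B + d" using assms(2)[OF M] M assms(1) by simp
  finally show ?thesis .
qed simp

definition gap :: "nat \<Rightarrow> nat \<Rightarrow> nat" where
  "gap u v = nat \<bar>int u - int v\<bar>"

lemma gap_commute: "gap u v = gap v u"
  by (simp add: gap_def)

lemma gap_pos: "u \<noteq> v \<Longrightarrow> 0 < gap u v"
  by (simp add: gap_def)

lemma gap_less: "u < M \<Longrightarrow> v < M \<Longrightarrow> gap u v < M"
  by (simp add: gap_def)

lemma gap_double: "gap (2 * u) (2 * v) = 2 * gap u v"
  by (simp add: gap_def)

lemma gap_diff: "M \<le> u \<Longrightarrow> M \<le> v \<Longrightarrow> gap (u - M) (v - M) = gap u v"
  by (simp add: gap_def)

text \<open>A multiple \<open>a x mod M\<close> is close to \<open>a y mod M\<close> only if \<open>a (x - y)\<close> is close to one of the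
  few multiples \<open>h M\<close> with \<open>0 \<le> h \<le> x - y\<close>.\<close>

lemma card_close_multiples:
  fixes x y n c M :: nat
  assumes "x \<noteq> y" "x \<le> n" "y \<le> n" "c * (n + 1) \<le> M"
  shows "c * card {a. a < M \<and> c * gap (a * x mod M) (a * y mod M) < M} \<le> 5 * M"
  using assms
proof (induction y x rule: linorder_wlog)
  case (sym x y)
  then show ?case by (simp add: gap_commute)
next
  case (le y x)
  define z where "z = x - y"
  have z: "0 < z" "z \<le> n" "x = y + z" using le by (auto simp: z_def)
  show ?case
  proof (cases "c = 0")
    case False
    \<comment> \<open>\<open>A h\<close> collects the multipliers for which \<open>a z\<close> has
      distance less than \<open>M / c\<close> from \<open>h M\<close>.\<close>
    define A where "A h = {a. a < M \<and> int c * \<bar>int a * int z - int h * int M\<bar> < int M}" for h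
    have sub: "{a. a < M \<and> c * gap (a * x mod M) (a * y mod M) < M} \<subseteq> (\<Union>h\<in>{..z}. A h)"
    proof
      fix a assume "a \<in> {a. a < M \<and> c * gap (a * x mod M) (a * y mod M) < M}"
      then have a: "a < M" "c * gap (a * x mod M) (a * y mod M) < M" by auto
      \<comment> \<open>With \<open>h\<close> the difference of the quotients, the residues differ
        by exactly \<open>a z - h M\<close>.\<close>
      define h where "h = a * x div M - a * y div M"
      have "a * y div M \<le> a * x div M" using le by (intro div_le_mono) simp
      then have h: "int h = int (a * x div M) - int (a * y div M)" by (simp add: h_def)
      have residue: "int (a * x mod M) = int (a * x) - int (a * x div M) * int M" for x
        by (metis add_diff_cancel_left' div_mult_mod_eq of_nat_add of_nat_mult)
      have "int (a * x) = int (a * y) + int a * int z" by (simp add: z(3) algebra_simps)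
      then have eq: "int (a * x mod M) - int (a * y mod M) = int a * int z - int h * int M"
        unfolding h residue left_diff_distrib by linarith
      have "int (c * gap (a * x mod M) (a * y mod M)) < int M" using a(2) by linarith
      then have close: "int c * \<bar>int a * int z - int h * int M\<bar> < int M"
        unfolding gap_def eq by simp
      have "\<bar>int a * int z - int h * int M\<bar> \<le> int c * \<bar>int a * int z - int h * int M\<bar>"
        using False mult_right_mono[of 1 "int c" "\<bar>int a * int z - int h * int M\<bar>"] by simp
      then have "\<bar>int a * int z - int h * int M\<bar> < int M" using close by (rule le_less_trans)
      moreover have "int a * int z \<le> int M * int z" using a(1) by (intro mult_right_mono) auto
      ultimately have "int h * int M < (int z + 1) * int M" by (simp add: algebra_simps)
      then have "int h < int z + 1" using a(1) by (simp add: mult_less_cancel_right)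
      then show "a \<in> (\<Union>h\<in>{..z}. A h)" using a(1) close by (auto simp: A_def)
    qed
    have fin: "finite (A h)" for h unfolding A_def by simp
    \<comment> \<open>For two elements of \<open>A h\<close> the products with \<open>z\<close> are
      near the same \<open>h M\<close>, so the elements differ by at most
      \<open>2 M / (c z)\<close>.\<close>
    have cA: "c * z * card (A h) \<le> 2 * M + c * z" for h
    proof (rule card_spread[OF fin])
      fix a b assume "a \<in> A h" "b \<in> A h" and "b \<le> a"
      then have "int c * \<bar>int a * int z - int h * int M\<bar> < int M"
        "int c * \<bar>int b * int z - int h * int M\<bar> < int M" by (auto simp: A_def)
      moreover have "int c * w \<le> int c * \<bar>w\<bar>" "- (int c * w) \<le> int c * \<bar>w\<bar>" for w
        using mult_left_mono[of w "\<bar>w\<bar>" "int c"] mult_left_mono[of "- w" "\<bar>w\<bar>" "int c"] by auto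
      ultimately have "int c * (int a * int z - int h * int M) < int M"
        "- int M < int c * (int b * int z - int h * int M)"
        by (smt (verit))+
      then have "int c * (int a * int z - int h * int M) - int c * (int b * int z - int h * int M)
          \<le> 2 * int M" by simp
      then have "int (c * z * (a - b)) \<le> int (2 * M)"
        using \<open>b \<le> a\<close> by (simp add: of_nat_diff algebra_simps)
      then show "c * z * (a - b) \<le> 2 * M" by linarith
    qed
    have "card {a. a < M \<and> c * gap (a * x mod M) (a * y mod M) < M} \<le> card (\<Union>h\<in>{..z}. A h)"
      using sub fin by (intro card_mono) auto
    also have "\<dots> \<le> (\<Sum>h\<le>z. card (A h))" by (rule card_UN_le) simp
    finally have "c * z * card {a. a < M \<and> c * gap (a * x mod M) (a * y mod M) < M}
        \<le> c * z * (\<Sum>h\<le>z. card (A h))" by (rule mult_le_mono2)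
    also have "\<dots> = (\<Sum>h\<le>z. c * z * card (A h))" by (simp add: sum_distrib_left)
    also have "\<dots> \<le> (\<Sum>h\<le>z. 2 * M + c * z)" by (intro sum_mono cA)
    \<comment> \<open>Origin of the 5: \<open>z + 1 \<le> 2 z\<close> turns the first term into
      \<open>4 M z\<close>, and \<open>c (z + 1) \<le> c (n + 1) \<le> M\<close> bounds the second
      by \<open>z M\<close>.\<close>
    also have "\<dots> = 2 * M * (z + 1) + z * (c * (z + 1))" by (simp add: algebra_simps)
    also have "\<dots> \<le> 2 * M * (2 * z) + z * (c * (n + 1))"
      using z by (intro add_mono mult_le_mono) auto
    also have "\<dots> \<le> 2 * M * (2 * z) + z * M" using le(5) by simp
    also have "\<dots> = z * (5 * M)" by simp
    finally have "z * (c * card {a. a < M \<and> c * gap (a * x mod M) (a * y mod M) < M}) \<le> z * (5 * M)"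
      by (simp add: mult_ac)
    then show ?thesis using z(1) by simp
  qed simp
qed

text \<open>For \<open>0 < d\<close> this bounds how many leading binary digits two fractions at
  distance \<open>d / M\<close> share. At \<open>d = 0\<close> and positive \<open>M\<close> the set
  is infinite and \<open>card\<close> yields 0, hence the care about positive gaps below.\<close>

definition doublings :: "nat \<Rightarrow> nat \<Rightarrow> nat" where
  "doublings M d = card {j. 2 ^ j * d < M}"

lemma finite_doublings:
  assumes "0 < d"
  shows "finite {j. 2 ^ j * d < (M :: nat)}"
proof (rule finite_subset)
  have "j < M" if "2 ^ j * d < M" for j
  proof -
    have "j < 2 ^ j" by simp
    also have "2 ^ j * 1 \<le> 2 ^ j * d" using assms by (intro mult_le_mono2) simp
    finally show ?thesis using that by simp
  qed
  then show "{j. 2 ^ j * d < M} \<subseteq> {..<M}" by auto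
qed simp

lemma doublings_double:
  assumes "0 < d" "d < M"
  shows "doublings M d = Suc (doublings M (2 * d))"
proof -
  have "{j. 2 ^ j * d < M} = insert 0 (Suc ` {j. 2 ^ j * (2 * d) < M})"
  proof (rule set_eqI)
    fix j show "j \<in> {j. 2 ^ j * d < M} \<longleftrightarrow> j \<in> insert 0 (Suc ` {j. 2 ^ j * (2 * d) < M})"
      using assms by (cases j) (auto simp: mult_ac)
  qed
  then show ?thesis
    using finite_doublings[of "2 * d" M] assms(1) by (simp add: doublings_def card_image)
qed

definition pairs :: "nat set \<Rightarrow> (nat \<times> nat) set" where
  "pairs K = {(x, y). x \<in> K \<and> y \<in> K \<and> x \<noteq> y}"

lemma finite_pairs: "finite K \<Longrightarrow> finite (pairs K)"
  by (rule finite_subset[of _ "K \<times> K"]) (auto simp: pairs_def)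

lemma card_pairs_le: "finite K \<Longrightarrow> card (pairs K) \<le> card K * card K"
  by (subst card_cartesian_product[symmetric]) (rule card_mono, auto simp: pairs_def)

text \<open>Averaging over \<open>a\<close>: for one pair and one exponent \<open>j\<close>, at most
  \<open>5 M / (2 ^ j Q)\<close> multipliers make the residues too close. The geometric series over
  \<open>j\<close> gives \<open>10 M / Q\<close>, and at most \<open>Q ^ 2\<close> pairs give
  \<open>10 Q M\<close> in total, so some \<open>a\<close> gets at most \<open>10 Q\<close>.\<close>

lemma good_multiplier:
  fixes K :: "nat set" and M Q D n :: nat
  assumes K: "finite K" "card K \<le> Q" "K \<subseteq> {..n}" and Q: "0 < Q"
    and M: "M = (n + 1) * 2 ^ D" and D: "11 * Q + 1 \<le> D"
  shows "\<exists>a<M. (\<forall>(x, y) \<in> pairs K. 0 < gap (a * x mod M) (a * y mod M)) \<and>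
    (\<Sum>(x, y) \<in> pairs K. doublings M (Q * gap (a * x mod M) (a * y mod M))) \<le> 10 * Q"
proof -
  \<comment> \<open>Exponents are first cut off at \<open>R\<close>: below it
    \<open>j + Q \<le> D\<close>, so \<open>M\<close> is large enough for
    \<open>card_close_multiples\<close>. \<open>R\<close> exceeds \<open>10 Q\<close> so that the
    cut-off can be removed again.\<close>
  define R where "R = 10 * Q + 1"
  define d where "d a p = Q * gap (a * fst p mod M) (a * snd p mod M)" for a p
  define f where "f a p = card {j. j < R \<and> 2 ^ j * d a p < M}" for a p
  have bnd: "real (card {a. a < M \<and> 2 ^ j * d a p < M}) \<le> 5 * M / Q * (1/2) ^ j"
    if "j < R" "p \<in> pairs K" for j p
  proof -
    have "2 ^ j * Q * (n + 1) \<le> 2 ^ j * 2 ^ Q * (n + 1)"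
      by (intro mult_le_mono) (auto simp: less_imp_le)
    also have "\<dots> = 2 ^ (j + Q) * (n + 1)" by (simp add: power_add)
    also have "\<dots> \<le> 2 ^ D * (n + 1)"
      using that D by (intro mult_le_mono power_increasing) (auto simp: R_def)
    finally have "2 ^ j * Q * (n + 1) \<le> M" using M by (simp add: mult_ac)
    then have "2 ^ j * Q * card {a. a < M \<and> 2 ^ j * Q * gap (a * fst p mod M) (a * snd p mod M) < M} \<le> 5 * M"
      using that K(3) by (intro card_close_multiples[where n = n]) (auto simp: pairs_def)
    then have "2 ^ j * Q * card {a. a < M \<and> 2 ^ j * d a p < M} \<le> 5 * M"
      by (simp add: d_def mult_ac)
    then have "real (2 ^ j * Q * card {a. a < M \<and> 2 ^ j * d a p < M}) \<le> real (5 * M)"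
      by (simp only: of_nat_le_iff)
    then show ?thesis using Q by (simp add: field_simps power_divide)
  qed
  have "(\<Sum>a<M. \<Sum>p\<in>pairs K. f a p) = (\<Sum>p\<in>pairs K. \<Sum>a<M. \<Sum>j<R. of_bool (2 ^ j * d a p < M))"
    by (subst sum.swap) (simp add: f_def Int_def)
  also have "\<dots> = (\<Sum>p\<in>pairs K. \<Sum>j<R. card {a. a < M \<and> 2 ^ j * d a p < M})"
    by (rule sum.cong[OF refl], subst sum.swap) (simp add: Int_def)
  finally have "real (\<Sum>a<M. \<Sum>p\<in>pairs K. f a p)
      = (\<Sum>p\<in>pairs K. \<Sum>j<R. real (card {a. a < M \<and> 2 ^ j * d a p < M}))" by simp
  also have "\<dots> \<le> (\<Sum>p\<in>pairs K. \<Sum>j<R. 5 * M / Q * (1/2) ^ j)"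
    by (intro sum_mono bnd) auto
  also have "\<dots> = real (card (pairs K)) * (5 * M / Q * (\<Sum>j<R. (1/2) ^ j))"
    by (simp add: sum_distrib_left)
  also have "\<dots> \<le> real (Q * Q) * (5 * M / Q * 2)"
  proof (intro mult_mono)
    have "card (pairs K) \<le> Q * Q"
      using card_pairs_le[OF K(1)] mult_le_mono[OF K(2) K(2)] by linarith
    then show "real (card (pairs K)) \<le> real (Q * Q)" by (simp only: of_nat_le_iff)
    show "(\<Sum>j<R. (1/2 :: real) ^ j) \<le> 2" by (subst sum_gp_strict) simp
  qed (auto intro!: sum_nonneg divide_nonneg_nonneg mult_nonneg_nonneg)
  also have "\<dots> = real (\<Sum>a<M. 10 * Q)" using Q by (simp add: field_simps)
  finally have total: "(\<Sum>a<M. \<Sum>p\<in>pairs K. f a p) \<le> (\<Sum>a<M. 10 * Q)" by (simp only: of_nat_le_iff)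
  have "0 < M" using M by simp
  have "\<exists>a<M. (\<Sum>p\<in>pairs K. f a p) \<le> 10 * Q"
  proof (rule ccontr)
    assume "\<not> ?thesis"
    then have "\<forall>a\<in>{..<M}. 10 * Q < (\<Sum>p\<in>pairs K. f a p)" by auto
    then have "(\<Sum>a<M. 10 * Q) < (\<Sum>a<M. \<Sum>p\<in>pairs K. f a p)"
      using \<open>0 < M\<close> by (intro sum_strict_mono) auto
    then show False using total by simp
  qed
  then obtain a where a: "a < M" "(\<Sum>p\<in>pairs K. f a p) \<le> 10 * Q" by blast
  have *: "0 < d a p \<and> doublings M (d a p) = f a p" if "p \<in> pairs K" for p
  proof -
    have "f a p \<le> (\<Sum>p\<in>pairs K. f a p)"
      using that finite_pairs[OF K(1)] by (intro member_le_sum) auto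
    \<comment> \<open>Some exponent below \<open>R\<close> is not counted; then no larger one is
      either, so the cut-off loses nothing, and the gap is nonzero.\<close>
    then have "f a p < R" using a(2) by (simp add: R_def)
    then have "{j. j < R \<and> 2 ^ j * d a p < M} \<noteq> {..<R}"
      unfolding f_def by (metis card_lessThan less_irrefl)
    then obtain i where i: "i < R" "M \<le> 2 ^ i * d a p" by fastforce
    have "j < R" if "2 ^ j * d a p < M" for j
    proof (rule ccontr)
      assume "\<not> j < R"
      then have "(2::nat) ^ i \<le> 2 ^ j" using i(1) by (intro power_increasing) auto
      then have "2 ^ i * d a p \<le> 2 ^ j * d a p" by (rule mult_le_mono1)
      then show False using i(2) that by linarith
    qed
    then have "{j. 2 ^ j * d a p < M} = {j. j < R \<and> 2 ^ j * d a p < M}" by auto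
    moreover have "0 < d a p" using i(2) \<open>0 < M\<close> by (cases "d a p") auto
    ultimately show ?thesis by (simp add: doublings_def f_def)
  qed
  have "(\<Sum>p\<in>pairs K. doublings M (d a p)) \<le> 10 * Q"
    using a(2) * by simp
  then have "(\<Sum>(x, y) \<in> pairs K. doublings M (Q * gap (a * x mod M) (a * y mod M))) \<le> 10 * Q"
    by (simp add: d_def case_prod_beta)
  moreover have "\<forall>(x, y) \<in> pairs K. 0 < gap (a * x mod M) (a * y mod M)"
    using * by (fastforce simp: d_def)
  ultimately show ?thesis using a(1) by blast
qed

section \<open>Separating a set by splitting labels\<close>

type_synonym labeling = "(nat \<Rightarrow> nat) \<times> (nat \<Rightarrow> nat) \<times> nat"

text \<open>A labeling \<open>(r, l, u)\<close> consists of the remaining fractional parts \<open>r v / M\<close>, the labels \<open>l v\<close>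
  and the next unused label \<open>u\<close>. Splitting label \<open>t\<close> reads off one more binary digit.\<close>

definition split_label :: "nat \<Rightarrow> bool \<Rightarrow> nat \<Rightarrow> labeling \<Rightarrow> labeling" where
  "split_label M b t = (\<lambda>(r, l, u). if b then
     (\<lambda>v. if l v = t then (if 2 * r v < M then 2 * r v else 2 * r v - M) else r v,
      \<lambda>v. if l v = t then (if 2 * r v < M then u else u + 1) else l v, u + 2) else (r, l, u))"

text \<open>Fresh labels are numbered from the counter on. As long as the counter exceeds the label
  being split, one increasing sweep also reaches the labels created on the way.\<close>

primrec split_labels :: "nat \<Rightarrow> (nat \<Rightarrow> bool) \<Rightarrow> labeling \<Rightarrow> nat \<Rightarrow> labeling" where
  "split_labels M w \<sigma> 0 = \<sigma>"
| "split_labels M w \<sigma> (Suc t) = split_label M (w t) t (split_labels M w \<sigma> t)"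

lemma split_labels_cong:
  "(\<And>i. i < t \<Longrightarrow> w i = w' i) \<Longrightarrow> split_labels M w \<sigma> t = split_labels M w' \<sigma> t"
  by (induction t) auto

lemma split_labels_bound:
  assumes "split_labels M w (r, l, u) t = (r', l', u')" "\<And>v. v \<in> K \<Longrightarrow> l v \<le> u"
  shows "u' \<le> u + 2 * t \<and> (\<forall>v\<in>K. l' v \<le> u + 2 * t)"
  using assms
proof (induction t arbitrary: r' l' u')
  case (Suc t)
  obtain r1 l1 u1 where 1: "split_labels M w (r, l, u) t = (r1, l1, u1)" by (metis prod_cases3)
  show ?case using Suc.IH[OF 1] Suc.prems 1
    by (fastforce simp: split_label_def split: if_splits)
qed auto

text \<open>A pair that stays together doubles its gap, which has to remain below \<open>M\<close>;
  so each summand limits how many more splits of its common label the pair survives.\<close>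

definition potential :: "nat \<Rightarrow> nat set \<Rightarrow> (nat \<Rightarrow> nat) \<Rightarrow> (nat \<Rightarrow> nat) \<Rightarrow> nat" where
  "potential M K r l =
    (\<Sum>(x, y)\<in>pairs K. if l x = l y then doublings M (gap (r x) (r y)) else 0)"

definition crowded :: "nat set \<Rightarrow> nat \<Rightarrow> labeling \<Rightarrow> bool" where
  "crowded K t = (\<lambda>(r, l, u). \<exists>(x, y) \<in> pairs K. l x = t \<and> l y = t)"

text \<open>Splitting exactly the crowded labels: two elements that stay together double their gap,
  hence every split lowers the potential.\<close>

lemma separating_splits:
  fixes K :: "nat set"
  assumes K: "finite K" and init: "\<And>x. x \<in> K \<Longrightarrow> r x < M \<and> l x < u"
    and inj: "\<And>x y. (x, y) \<in> pairs K \<Longrightarrow> l x = l y \<Longrightarrow> r x \<noteq> r y"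
    and L: "u + 2 * potential M K r l \<le> L"
  shows "\<exists>w. inj_on (fst (snd (split_labels M w (r, l, u) L))) K"
proof -
  \<comment> \<open>Run and word arise together: bit \<open>t\<close> asks whether label
    \<open>t\<close> is crowded in the state produced by the earlier bits.\<close>
  define \<sigma> where "\<sigma> = rec_nat (r, l, u) (\<lambda>t s. split_label M (crowded K t s) t s)"
  define w where "w t = crowded K t (\<sigma> t)" for t
  have [simp]: "\<sigma> 0 = (r, l, u)" and \<sigma>_Suc: "\<sigma> (Suc t) = split_label M (w t) t (\<sigma> t)" for t
    by (simp_all add: \<sigma>_def w_def)
  have w: "split_labels M w (r, l, u) t = \<sigma> t" for t
    by (induction t) (simp_all add: \<sigma>_Suc)
  \<comment> \<open>A shared label has not had its round yet, and every split pays for its two new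
    labels with at least one unit of potential.\<close>
  have inv: "(\<forall>x\<in>K. r' x < M \<and> l' x < u') \<and>
      (\<forall>(x, y)\<in>pairs K. l' x = l' y \<longrightarrow> r' x \<noteq> r' y \<and> t \<le> l' x) \<and>
      u' + 2 * potential M K r' l' \<le> L"
    if "\<sigma> t = (r', l', u')" for t r' l' u'
    using that
  proof (induction t arbitrary: r' l' u')
    case 0
    then show ?case using init inj L by auto
  next
    case (Suc t)
    obtain r1 l1 u1 where 1: "\<sigma> t = (r1, l1, u1)" by (metis prod_cases3)
    note IH = Suc.IH[OF 1]
    have IH2: "r1 x \<noteq> r1 y" "t \<le> l1 x" if "(x, y) \<in> pairs K" "l1 x = l1 y" for x y
      using IH that by auto
    show ?case
    proof (cases "w t")
      case False
      then have "r' = r1" "l' = l1" "u' = u1" using Suc.prems 1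
        by (auto simp: \<sigma>_Suc split_label_def)
      moreover have "Suc t \<le> l1 x" if "(x, y) \<in> pairs K" "l1 x = l1 y" for x y
      proof -
        have "t \<le> l1 x" using IH2(2) that .
        moreover have "l1 x \<noteq> t" using False that 1 by (auto simp: w_def crowded_def)
        ultimately show ?thesis by simp
      qed
      ultimately show ?thesis using IH by auto
    next
      case True
      then have r': "r' v = (if l1 v = t then (if 2 * r1 v < M then 2 * r1 v else 2 * r1 v - M) else r1 v)"
        and l': "l' v = (if l1 v = t then (if 2 * r1 v < M then u1 else u1 + 1) else l1 v)"
        and u': "u' = u1 + 2" for v
        using Suc.prems 1 by (auto simp: \<sigma>_Suc split_label_def)
      obtain a b where ab: "(a, b) \<in> pairs K" "l1 a = t" "l1 b = t"
        using True 1 by (auto simp: w_def crowded_def)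
      have "t < u1" using ab IH by (auto simp: pairs_def)
      have bd: "\<forall>x\<in>K. r' x < M \<and> l' x < u'"
        using IH by (auto simp: r' l' u')
      \<comment> \<open>Fresh labels are at least \<open>u1\<close> and old ones are below it, so
        equal new labels come from equal old ones. Inside label \<open>t\<close> the digits then
        agree, so \<open>M\<close> is subtracted from both elements or from neither.\<close>
      have together: "(l1 x = l1 y \<and> l1 x \<noteq> t \<and> r' x = r1 x \<and> r' y = r1 y \<and> l' x = l1 x) \<or>
          (l1 x = t \<and> l1 y = t \<and> gap (r' x) (r' y) = 2 * gap (r1 x) (r1 y) \<and> u1 \<le> l' x)"
        if "(x, y) \<in> pairs K" "l' x = l' y" for x y
      proof -
        have "l1 x < u1" "l1 y < u1" "r1 x < M" "r1 y < M" using that IH by (auto simp: pairs_def)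
        then show ?thesis
          using that(2) by (cases "l1 x = t"; cases "l1 y = t"; cases "2 * r1 x < M"; cases "2 * r1 y < M")
            (simp_all add: r' l' gap_double gap_diff)
      qed
      have sep: "\<forall>(x, y)\<in>pairs K. l' x = l' y \<longrightarrow> r' x \<noteq> r' y \<and> Suc t \<le> l' x"
      proof clarify
        fix x y assume xy: "(x, y) \<in> pairs K" "l' x = l' y"
        from together[OF xy] show "r' x \<noteq> r' y \<and> Suc t \<le> l' x"
        proof (elim disjE conjE)
          assume "l1 x = l1 y" "l1 x \<noteq> t" "r' x = r1 x" "r' y = r1 y" "l' x = l1 x"
          with IH2[OF xy(1)] show ?thesis by simp
        next
          assume *: "l1 x = t" "l1 y = t" "gap (r' x) (r' y) = 2 * gap (r1 x) (r1 y)" "u1 \<le> l' x"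
          then have "0 < gap (r1 x) (r1 y)" using IH2(1)[OF xy(1)] by (simp add: gap_pos)
          then have "r' x \<noteq> r' y" using *(3) by (auto simp: gap_def)
          with *(4) \<open>t < u1\<close> show ?thesis by simp
        qed
      qed
      let ?f = "\<lambda>r l (x, y). if l x = l y then doublings M (gap (r x) (r y)) else 0"
      have dec: "gap (r1 x) (r1 y) < M \<and> 0 < gap (r1 x) (r1 y)"
        if "(x, y) \<in> pairs K" "l1 x = l1 y" for x y
        using IH2(1)[OF that] IH that(1) by (auto simp: pairs_def gap_pos gap_less)
      have le: "?f r' l' p \<le> ?f r1 l1 p" if "p \<in> pairs K" for p
      proof -
        obtain x y where p: "p = (x, y)" by (cases p)
        show ?thesis
        proof (cases "l' x = l' y")
          case True
          have xy: "(x, y) \<in> pairs K" using that p by simp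
          from together[OF xy True] show ?thesis
          proof (elim disjE conjE)
            assume "l1 x = t" "l1 y = t" "gap (r' x) (r' y) = 2 * gap (r1 x) (r1 y)"
            then show ?thesis using dec[OF xy] doublings_double[of "gap (r1 x) (r1 y)" M] p True by simp
          qed (simp add: p)
        qed (simp add: p)
      qed
      \<comment> \<open>The crowded pair is either parted, losing a positive summand, or doubles its
        gap.\<close>
      have less: "?f r' l' (a, b) < ?f r1 l1 (a, b)"
      proof (cases "l' a = l' b")
        case True
        then have "gap (r' a) (r' b) = 2 * gap (r1 a) (r1 b)" using together[OF ab(1)] ab by blast
        then show ?thesis
          using dec[OF ab(1)] ab True doublings_double[of "gap (r1 a) (r1 b)" M] by simp
      next
        case False
        then show ?thesis
          using dec[OF ab(1)] ab doublings_double[of "gap (r1 a) (r1 b)" M] by simp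
      qed
      have "potential M K r' l' < potential M K r1 l1"
        unfolding potential_def using le less ab(1) finite_pairs[OF K]
        by (intro sum_strict_mono_ex1) blast+
      then have "u' + 2 * potential M K r' l' \<le> L" using IH u' by linarith
      with bd sep show ?thesis by blast
    qed
  qed
  obtain r' l' u' where L': "\<sigma> L = (r', l', u')" by (metis prod_cases3)
  \<comment> \<open>A label still shared after \<open>L\<close> rounds would be at least
    \<open>L\<close>, yet all labels are below \<open>u' \<le> L\<close>.\<close>
  have "inj_on l' K"
  proof (rule inj_onI, rule ccontr)
    fix x y assume "x \<in> K" "y \<in> K" "l' x = l' y" "x \<noteq> y"
    then have "L \<le> l' x" "l' x < u'" "u' \<le> L" using inv[OF L'] by (auto simp: pairs_def)
    then show False by simp
  qed
  then show ?thesis by (intro exI[of _ w]) (simp add: w L')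
qed

text \<open>The quotient numbers the interval that contains the fraction of \<open>v\<close>; the
  remainder is the position inside it, rescaled to the range below \<open>M\<close>.\<close>

definition initial_labeling :: "nat \<Rightarrow> nat \<Rightarrow> nat \<Rightarrow> labeling" where
  "initial_labeling M Q a = (\<lambda>v. Q * (a * v mod M) mod M, \<lambda>v. Q * (a * v mod M) div M, Q)"

text \<open>The word is read off the binary digits of \<open>w\<close>, so all words can be tried by
  counting.\<close>

definition label :: "nat \<Rightarrow> nat \<Rightarrow> nat \<Rightarrow> nat \<Rightarrow> nat \<Rightarrow> nat \<Rightarrow> nat" where
  "label M Q L a w = fst (snd (split_labels M (\<lambda>t. t \<in> set_decode w) (initial_labeling M Q a) L))"

text \<open>Not strict, so as to include \<open>Q = 0\<close>.\<close>

lemma initial_label_le: "0 < M \<Longrightarrow> Q * (a * v mod M) div M \<le> (Q :: nat)"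
  by (metis div_le_mono less_imp_le_nat mod_less_divisor mult_le_mono2 nonzero_mult_div_cancel_right
      not_gr_zero)

lemma label_le:
  assumes "0 < M"
  shows "label M Q L a w v \<le> Q + 2 * L"
proof -
  obtain r l u where 1: "split_labels M (\<lambda>t. t \<in> set_decode w) (initial_labeling M Q a) L = (r, l, u)"
    by (metis prod_cases3)
  show ?thesis
    using split_labels_bound[OF 1[unfolded initial_labeling_def], of UNIV]
      initial_label_le[OF assms] 1 by (simp add: label_def)
qed

lemma set_encode_less:
  assumes "A \<subseteq> {..<D}"
  shows "set_encode A < 2 ^ D"
proof -
  have "set_encode A \<le> set_encode {..<D}" unfolding set_encode_def using assms by (intro sum_mono2) auto
  also have "\<dots> < 2 ^ D" by (simp add: set_encode_def lessThan_atLeast0 sum_power2)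
  finally show ?thesis .
qed

text \<open>A good multiplier bounds the initial potential by \<open>10 Q\<close>, so
  \<open>Q + 2 (10 Q) = 21 Q\<close> rounds suffice.\<close>

lemma separating_label:
  fixes K :: "nat set" and M Q D n :: nat
  assumes K: "finite K" "card K \<le> Q" "K \<subseteq> {..n}"
    and M: "M = (n + 1) * 2 ^ D" and D: "11 * Q + 1 \<le> D" "L \<le> D" and L: "21 * Q \<le> L"
  shows "\<exists>a<M. \<exists>w<2 ^ D. inj_on (label M Q L a w) K"
proof (cases "Q = 0")
  case True
  then have "K = {}" using K by simp
  then show ?thesis using M by (intro exI[of _ 0] conjI) auto
next
  case False
  have "0 < M" using M by simp
  obtain a where a: "a < M" "\<forall>(x, y) \<in> pairs K. 0 < gap (a * x mod M) (a * y mod M)"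
    "(\<Sum>(x, y) \<in> pairs K. doublings M (Q * gap (a * x mod M) (a * y mod M))) \<le> 10 * Q"
    using good_multiplier[OF K _ M D(1)] False by auto
  define r l where "r v = Q * (a * v mod M) mod M" and "l v = Q * (a * v mod M) div M" for v
  \<comment> \<open>Inside one interval the quotients cancel.\<close>
  have gap: "gap (r x) (r y) = Q * gap (a * x mod M) (a * y mod M)" if "l x = l y" for x y
  proof -
    have residue: "int (r x) = int Q * int (a * x mod M) - int (l x) * int M" for x
      by (metis add_diff_cancel_left' div_mult_mod_eq l_def of_nat_add of_nat_mult r_def)
    have "int (r x) - int (r y) = int Q * (int (a * x mod M) - int (a * y mod M))"
      unfolding residue right_diff_distrib using that by simp
    then show ?thesis by (simp add: gap_def abs_mult nat_mult_distrib)
  qed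
  have "potential M K r l \<le> (\<Sum>(x, y) \<in> pairs K. doublings M (Q * gap (a * x mod M) (a * y mod M)))"
    unfolding potential_def by (intro sum_mono) (auto simp: gap)
  then have "Q + 2 * potential M K r l \<le> L" using a(3) L by linarith
  moreover have "r x < M \<and> l x < Q" for x
    using \<open>0 < M\<close> False by (simp add: r_def l_def div_less_iff_less_mult mult.commute)
  moreover have "r x \<noteq> r y" if "(x, y) \<in> pairs K" "l x = l y" for x y
  proof -
    have "0 < gap (a * x mod M) (a * y mod M)" using a(2) that by auto
    then have "0 < gap (r x) (r y)" using gap that(2) False by simp
    then show ?thesis by (auto simp: gap_def)
  qed
  ultimately obtain w where w: "inj_on (fst (snd (split_labels M w (r, l, Q) L))) K"
    using separating_splits[OF K(1), of r M l Q L] by blast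
  \<comment> \<open>Only the first \<open>L\<close> bits are read, so the word can be cut to a
    number below \<open>2 ^ D\<close>.\<close>
  define W where "W = set_encode {t. t < L \<and> w t}"
  have dec: "set_decode W = {t. t < L \<and> w t}" by (simp add: W_def)
  have "W < 2 ^ D" unfolding W_def using D by (intro set_encode_less) auto
  moreover have "split_labels M (\<lambda>t. t \<in> set_decode W) (r, l, Q) L = split_labels M w (r, l, Q) L"
    by (rule split_labels_cong) (simp add: dec)
  then have "inj_on (label M Q L a W) K"
    using w by (simp add: label_def initial_labeling_def r_def[abs_def] l_def[abs_def])
  ultimately show ?thesis using a(1) by blast
qed

section \<open>Optimal partitions of the label set\<close>

lemma set_decode_mono: "S \<subseteq> set_decode B \<Longrightarrow> set_encode S \<le> B"
  by (metis finite_set_decode set_decode_inverse set_encode_def sum_mono2 zero_le)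

text \<open>Subtraction without borrows is difference of digit sets, so the machine forms
  \<open>S - B\<close> in one operation.\<close>

lemma set_decode_diff:
  assumes "set_decode B \<subseteq> set_decode S"
  shows "set_decode (S - B) = set_decode S - set_decode B" and "B \<le> S"
proof -
  have "set_encode (set_decode S - set_decode B) + set_encode (set_decode B)
      = set_encode (set_decode S)"
    unfolding set_encode_def using assms by (intro sum.subset_diff[symmetric]) auto
  then have "set_encode (set_decode S - set_decode B) + B = S" by simp
  then have "S - B = set_encode (set_decode S - set_decode B)" "B \<le> S" by linarith+
  then show "set_decode (S - B) = set_decode S - set_decode B" "B \<le> S"
    by (simp_all add: finite_subset[of "set_decode S - set_decode B" "set_decode S"])
qed

lemma set_decode_less:
  assumes "S < 2 ^ D" "i \<in> set_decode S"
  shows "i < D"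
proof (rule ccontr)
  assume "\<not> i < D"
  then have "(2 :: nat) ^ D \<le> 2 ^ i" by (intro power_increasing) auto
  also have "2 ^ i = set_encode {i}" by (simp add: set_encode_def)
  also have "\<dots> \<le> S" using assms(2) by (intro set_decode_mono) simp
  finally show False using assms(1) by simp
qed

text \<open>Edge number \<open>e\<close> joins the vertices \<open>ea e\<close> and \<open>eb e\<close> and has color \<open>ec e\<close>.\<close>

locale edge_list =
  fixes m :: nat and ea eb ec :: "nat \<Rightarrow> nat"
begin

section \<open>Stable sets of edge indices and the recursion for them\<close>

definition ends :: "nat set \<Rightarrow> nat set" where
  "ends T = ea ` T \<union> eb ` T"

definition stable_indices :: "nat set \<Rightarrow> bool" where
  "stable_indices T \<longleftrightarrow> T \<subseteq> {..<m} \<and>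
    (\<forall>e\<in>T. \<forall>e'\<in>T. {ea e, eb e} \<inter> {ea e', eb e'} \<noteq> {} \<longrightarrow> ec e = ec e')"

definition inside :: "(nat \<Rightarrow> nat) \<Rightarrow> nat \<Rightarrow> nat \<Rightarrow> bool" where
  "inside lab S e \<longleftrightarrow> lab (ea e) \<in> set_decode S \<and> lab (eb e) \<in> set_decode S"

definition color_count :: "(nat \<Rightarrow> nat) \<Rightarrow> nat \<Rightarrow> nat \<Rightarrow> nat \<Rightarrow> nat" where
  "color_count lab S e c = card {e'. e' < e \<and> inside lab S e' \<and> ec e' = c}"

lemma color_count_Suc:
  "color_count lab S (Suc e) c = color_count lab S e c + of_bool (inside lab S e \<and> ec e = c)"
proof -
  have "{e'. e' < Suc e \<and> inside lab S e' \<and> ec e' = c} =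
      (if inside lab S e \<and> ec e = c then {e} else {}) \<union> {e'. e' < e \<and> inside lab S e' \<and> ec e' = c}"
    by (auto simp: less_Suc_eq)
  then show ?thesis by (auto simp: color_count_def)
qed

text \<open>A running maximum that looks only at the color of the current edge, the only one whose
  count grows. The next two lemmas identify it with the maximum over all colors.\<close>

primrec weight :: "(nat \<Rightarrow> nat) \<Rightarrow> nat \<Rightarrow> nat \<Rightarrow> nat" where
  "weight lab S 0 = 0"
| "weight lab S (Suc e) = (if inside lab S e
     then max (weight lab S e) (color_count lab S (Suc e) (ec e)) else weight lab S e)"

lemma color_count_le_weight: "color_count lab S e c \<le> weight lab S e"
proof (induction e)
  case (Suc e)
  then show ?case by (auto simp: color_count_Suc le_max_iff_disj)
qed (simp add: color_count_def)

lemma weight_attained: "\<exists>c. weight lab S e \<le> color_count lab S e c"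
proof (induction e)
  case (Suc e)
  then obtain c where "weight lab S e \<le> color_count lab S e c" by blast
  also have "\<dots> \<le> color_count lab S (Suc e) c" by (simp add: color_count_Suc)
  finally show ?case by (auto simp: max_def)
qed simp

text \<open>One evaluation of the recursion with \<open>F\<close> as a parameter; a table is correct
  if \<open>F S = best lab F S N\<close>. The condition \<open>0 < B\<close> excludes the empty
  part.\<close>

primrec best :: "(nat \<Rightarrow> nat) \<Rightarrow> (nat \<Rightarrow> nat) \<Rightarrow> nat \<Rightarrow> nat \<Rightarrow> nat" where
  "best lab F S 0 = 0"
| "best lab F S (Suc B) = (if 0 < B \<and> set_decode B \<subseteq> set_decode S
     then max (best lab F S B) (weight lab B m + F (S - B)) else best lab F S B)"

lemma best_ge:
  assumes "0 < B" "set_decode B \<subseteq> set_decode S" "B < N"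
  shows "weight lab B m + F (S - B) \<le> best lab F S N"
  using assms(3)
proof (induction N)
  case (Suc N)
  then show ?case using assms(1,2) by (cases "B = N") auto
qed simp

lemma best_attained:
  "best lab F S N = 0 \<or> (\<exists>B<N. 0 < B \<and> set_decode B \<subseteq> set_decode S \<and>
    best lab F S N = weight lab B m + F (S - B))"
  by (induction N) (auto simp: max_def less_Suc_eq)

text \<open>A nonempty part makes \<open>S - B\<close> smaller than \<open>S\<close>, so a table can
  be filled in increasing order.\<close>

lemma best_cong:
  assumes "\<And>S'. S' < S \<Longrightarrow> F S' = F' S'"
  shows "best lab F S N = best lab F' S N"
proof (induction N)
  case (Suc N)
  have "F (S - N) = F' (S - N)" if "0 < N" "set_decode N \<subseteq> set_decode S"
    using set_decode_diff(2)[OF that(2)] that(1) assms by simp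
  then show ?case using Suc by simp
qed simp

text \<open>Valid for every labeling, injective or not: edges inside disjoint sets of labels share
  no endpoint, so one color class per part can be united.\<close>

lemma best_sound:
  assumes "\<And>S. S < N \<Longrightarrow> F S = best lab F S N" "S < N"
  shows "\<exists>T. stable_indices T \<and> F S \<le> card T \<and> (\<forall>e\<in>T. inside lab S e)"
  using assms(2)
proof (induction S rule: less_induct)
  case (less S)
  show ?case
  proof (cases "F S = 0")
    case True
    then show ?thesis by (intro exI[of _ "{}"]) (simp add: stable_indices_def)
  next
    case False
    then obtain B where B: "B < N" "0 < B" "set_decode B \<subseteq> set_decode S"
        "F S = weight lab B m + F (S - B)"
      using best_attained[of lab F S N] assms(1)[OF less.prems] by metis
    note d = set_decode_diff[OF B(3)]
    have "S - B < S" using B(2) d(2) by simp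
    obtain T where T: "stable_indices T" "F (S - B) \<le> card T" "\<forall>e\<in>T. inside lab (S - B) e"
      using less.IH[of "S - B"] \<open>S - B < S\<close> less.prems by (meson less_trans)
    obtain c where c: "weight lab B m \<le> color_count lab B m c" using weight_attained by blast
    define U where "U = {e. e < m \<and> inside lab B e \<and> ec e = c}"
    have "finite T" using T(1) by (auto simp: stable_indices_def finite_subset)
    have apart: "{ea e, eb e} \<inter> {ea e', eb e'} = {}" if "e \<in> T" "e' \<in> U" for e e'
    proof -
      have "lab (ea e) \<notin> set_decode B" "lab (eb e) \<notin> set_decode B"
        "lab (ea e') \<in> set_decode B" "lab (eb e') \<in> set_decode B"
        using T(3) that d(1) by (auto simp: inside_def U_def)
      then show ?thesis by auto
    qed
    then have disj: "T \<inter> U = {}" by blast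
    have "stable_indices (T \<union> U)"
      unfolding stable_indices_def
    proof (intro conjI ballI impI)
      show "T \<union> U \<subseteq> {..<m}" using T(1) by (auto simp: stable_indices_def U_def)
      fix e e' assume e: "e \<in> T \<union> U" "e' \<in> T \<union> U" "{ea e, eb e} \<inter> {ea e', eb e'} \<noteq> {}"
      then consider "e \<in> T" "e' \<in> T" | "e \<in> U" "e' \<in> U"
        using apart[of e e'] apart[of e' e] by (auto simp: Int_commute)
      then show "ec e = ec e'"
      proof cases
        case 1
        then show ?thesis using T(1) e(3) unfolding stable_indices_def by blast
      qed (simp add: U_def)
    qed
    moreover have "F S \<le> card (T \<union> U)"
      using B(4) T(2) c disj \<open>finite T\<close>
      by (simp add: card_Un_disjoint U_def color_count_def)
    moreover have "\<forall>e\<in>T \<union> U. inside lab S e"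
      using T(3) B(3) d(1) by (auto simp: inside_def U_def)
    ultimately show ?thesis by blast
  qed
qed

text \<open>The color classes of a stable set have disjoint sets of endpoints, hence of labels.\<close>

lemma best_complete:
  assumes F: "\<And>S. S < 2 ^ D \<Longrightarrow> F S = best lab F S (2 ^ D)"
    and T: "stable_indices T" and lab: "inj_on lab (ends T)" "\<And>v. v \<in> ends T \<Longrightarrow> lab v < D"
  shows "\<exists>S<2 ^ D. card T \<le> F S"
proof -
  have "finite T" using T by (auto simp: stable_indices_def finite_subset)
  define L where "L G = lab ` ends {e \<in> T. ec e \<in> G}" for G
  have LD: "L G \<subseteq> {..<D}" for G using lab(2) by (auto simp: L_def ends_def)
  have dec [simp]: "set_decode (set_encode (L G)) = L G" for G
    using LD[of G] by (intro set_encode_inverse) (auto simp: finite_subset)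
  \<comment> \<open>Induction over the colors; the labels of color \<open>c\<close> are the part
    that is split off.\<close>
  have main: "card {e \<in> T. ec e \<in> G} \<le> F (set_encode (L G))" if "finite G" "G \<subseteq> ec ` T" for G
    using that
  proof (induction G rule: finite_induct)
    case (insert c G)
    let ?B = "set_encode (L {c})" and ?S = "set_encode (L (insert c G))"
    have un: "L (insert c G) = L {c} \<union> L G" by (auto simp: L_def ends_def)
    have "L {c} \<inter> L G = {}"
    proof (rule ccontr)
      assume "L {c} \<inter> L G \<noteq> {}"
      then obtain v v' where v: "v \<in> ends {e \<in> T. ec e \<in> {c}}" "v' \<in> ends {e \<in> T. ec e \<in> G}"
          "lab v = lab v'" unfolding L_def by blast
      \<comment> \<open>Injectivity turns a common label into a common endpoint, where stability
        forbids two colors.\<close>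
      have "v = v'" by (rule inj_onD[OF lab(1) v(3)]) (use v in \<open>auto simp: ends_def\<close>)
      then obtain e e' where "e \<in> T" "ec e = c" "e' \<in> T" "ec e' \<in> G"
          "v \<in> {ea e, eb e}" "v \<in> {ea e', eb e'}"
        using v by (auto simp: ends_def)
      then have "ec e = ec e'" using T unfolding stable_indices_def by blast
      then show False using insert.hyps \<open>ec e = c\<close> \<open>ec e' \<in> G\<close> by auto
    qed
    then have diff: "L (insert c G) - L {c} = L G" using un by blast
    have sub: "set_decode ?B \<subseteq> set_decode ?S" unfolding dec using un by blast
    have "set_decode (?S - ?B) = L G" using set_decode_diff(1)[OF sub] diff by simp
    then have SB: "?S - ?B = set_encode (L G)" by (metis set_decode_inverse)
    obtain e where "e \<in> T" "ec e = c" using insert.prems by auto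
    then have "lab (ea e) \<in> L {c}" by (auto simp: L_def ends_def)
    then have "set_decode ?B \<noteq> {}" unfolding dec by blast
    then have "?B \<noteq> 0" by (metis set_decode_zero)
    have less: "?B < 2 ^ D" "?S < 2 ^ D" using LD set_encode_less by blast+
    have "{e \<in> T. ec e \<in> {c}} \<subseteq> {e. e < m \<and> inside lab ?B e \<and> ec e = c}"
    proof
      fix e assume e: "e \<in> {e \<in> T. ec e \<in> {c}}"
      then have "lab (ea e) \<in> L {c}" "lab (eb e) \<in> L {c}"
        unfolding L_def ends_def by blast+
      moreover have "e < m" using e T unfolding stable_indices_def by blast
      ultimately show "e \<in> {e. e < m \<and> inside lab ?B e \<and> ec e = c}"
        using e unfolding inside_def dec by blast
    qed
    then have "card {e \<in> T. ec e \<in> {c}} \<le> color_count lab ?B m c"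
      unfolding color_count_def by (intro card_mono) auto
    also have "\<dots> \<le> weight lab ?B m" by (rule color_count_le_weight)
    finally have w: "card {e \<in> T. ec e \<in> {c}} \<le> weight lab ?B m" .
    have "{e \<in> T. ec e \<in> insert c G} = {e \<in> T. ec e \<in> {c}} \<union> {e \<in> T. ec e \<in> G}" by auto
    then have "card {e \<in> T. ec e \<in> insert c G} \<le> card {e \<in> T. ec e \<in> {c}} + card {e \<in> T. ec e \<in> G}"
      by (simp only: card_Un_le)
    also have "\<dots> \<le> weight lab ?B m + F (?S - ?B)" using w insert SB by simp
    also have "\<dots> \<le> F ?S"
      using best_ge[of ?B ?S "2 ^ D" lab F] \<open>?B \<noteq> 0\<close> sub less F by simp
    finally show ?case .
  qed simp
  have "card T \<le> F (set_encode (L (ec ` T)))"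
    using main[of "ec ` T"] \<open>finite T\<close> by (simp add: Collect_mem_eq cong: conj_cong)
  then show ?thesis using set_encode_less[OF LD] by blast
qed

end

section \<open>The program\<close>

fun block :: "com list \<Rightarrow> com" where
  "block [] = Skip"
| "block (c # cs) = Seq c (block cs)"

lemma written_block [simp]:
  "written_regs (block []) = {}" "written_arrays (block []) = {}"
  "written_regs (block (c # cs)) = written_regs c \<union> written_regs (block cs)"
  "written_arrays (block (c # cs)) = written_arrays c \<union> written_arrays (block cs)"
  by simp_all

lemma runs_block_Nil: "Q s \<Longrightarrow> runs X (block []) s Q"
  by (simp add: runs_Skip)

lemma runs_block_Cons: "runs X c s (\<lambda>s'. runs X (block cs) s' Q) \<Longrightarrow> runs X (block (c # cs)) s Q"
  by (simp add: runs_Seq)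

declare block.simps [simp del]

lemmas runs_basic = runs_Skip runs_Assign runs_Store runs_Cond runs_block_Nil runs_block_Cons

text \<open>With \<open>Q = 2 k\<close>: since the initial potential is at most \<open>10 Q\<close> and a split creates two labels,
  \<open>L = Q + 2 (10 Q) = 42 k\<close> rounds of splitting suffice, and \<open>D = Q + 2 L + 2 = 86 k + 2\<close> exceeds all
  labels. \<open>N = 2\<^sup>D\<close> counts both the splitting words and the sets of labels.\<close>

definition parameters :: com where
  "parameters = block [
     Assign ''n'' (Cell ''in'' (Const 0)),
     Assign ''C'' (Cell ''in'' (Const 1)),
     Assign ''k'' (Cell ''in'' (Const 2)),
     Assign ''m'' (Cell ''in'' (Const 3)),
     Assign ''Q'' (Const 0),
     Assign ''L'' (Const 0),
     Assign ''D'' (Const 2),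
     For ''i'' ''k'' (block [
       Assign ''Q'' (Add (Var ''Q'') (Const 2)),
       Assign ''L'' (Add (Var ''L'') (Const 42)),
       Assign ''D'' (Add (Var ''D'') (Const 86))]),
     Assign ''N'' (Const 1),
     Assign ''M'' (Add (Var ''n'') (Const 1)),
     For ''i'' ''D'' (block [
       Assign ''N'' (Add (Var ''N'') (Var ''N'')),
       Assign ''M'' (Add (Var ''M'') (Var ''M''))])]"

text \<open>Without multiplication, multiples of \<open>k\<close> arise by repeated addition and
  powers of two by doubling.\<close>

lemma runs_parameters:
  assumes "mem s ''in'' 0 = n" "mem s ''in'' (Suc 0) = C" "mem s ''in'' 2 = k" "mem s ''in'' 3 = m"
    and "k \<le> X" "D \<le> X" "D = 86 * k + 2"
    and "\<And>s'. same_outside parameters s s' \<Longrightarrow> reg s' ''n'' = n \<Longrightarrow> reg s' ''C'' = C \<Longrightarrow>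
      reg s' ''k'' = k \<Longrightarrow> reg s' ''m'' = m \<Longrightarrow> reg s' ''Q'' = 2 * k \<Longrightarrow> reg s' ''L'' = 42 * k \<Longrightarrow>
      reg s' ''D'' = D \<Longrightarrow> reg s' ''N'' = 2 ^ D \<Longrightarrow> reg s' ''M'' = (n + 1) * 2 ^ D \<Longrightarrow> R s'"
  shows "runs X parameters s R"
proof (rule runs_conseq)
  show "runs X parameters s (\<lambda>s'. reg s' ''n'' = n \<and> reg s' ''C'' = C \<and> reg s' ''k'' = k \<and>
      reg s' ''m'' = m \<and> reg s' ''Q'' = 2 * k \<and> reg s' ''L'' = 42 * k \<and> reg s' ''D'' = D \<and>
      reg s' ''N'' = 2 ^ D \<and> reg s' ''M'' = (n + 1) * 2 ^ D)"
    unfolding parameters_def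
    apply (intro runs_basic)
    apply (rule runs_For[where N = k and Inv = "\<lambda>i s. reg s ''Q'' = 2 * i \<and> reg s ''L'' = 42 * i \<and> reg s ''D'' = 86 * i + 2"])
           apply (simp_all add: assms(1-6))
     apply (intro runs_basic, simp)
    apply (intro runs_basic)
    apply (rule runs_For[where N = D and Inv = "\<lambda>i s. reg s ''N'' = 2 ^ i \<and> reg s ''M'' = (n + 1) * 2 ^ i"])
           apply (simp_all add: same_outside_reg assms(1-6) assms(7)[symmetric, simplified])
     apply (intro runs_basic, simp)
    apply (intro runs_basic)
    apply (simp add: same_outside_reg assms(1-6))
    done
qed (use assms(8) in blast)

text \<open>The machine has no division, so binary digits are looked up in tables of halves and
  parities.\<close>

definition tables :: com where
  "tables = block [
     Assign ''h'' (Const 0),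
     Assign ''p'' (Const 0),
     For ''i'' ''N'' (block [
       Store ''half'' (Var ''i'') (Var ''h''),
       Store ''parity'' (Var ''i'') (Var ''p''),
       Cond (Lt (Var ''p'') (Const 1))
         (Assign ''p'' (Const 1))
         (block [Assign ''p'' (Const 0), Assign ''h'' (Add (Var ''h'') (Const 1))])])]"

lemma parity_step: "i mod 2 = 0 \<Longrightarrow> Suc i div 2 = i div 2 \<and> Suc i mod 2 = 1"
  and parity_step': "0 < i mod 2 \<Longrightarrow> Suc i div 2 = Suc (i div 2) \<and> Suc i mod 2 = 0"
  by presburger+

lemma runs_tables:
  assumes "reg s ''N'' = N" "N \<le> X"
    and "\<And>s'. same_outside tables s s' \<Longrightarrow>
      (\<And>x. x < N \<Longrightarrow> mem s' ''half'' x = x div 2 \<and> mem s' ''parity'' x = x mod 2) \<Longrightarrow> R s'"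
  shows "runs X tables s R"
proof (rule runs_conseq)
  show "runs X tables s (\<lambda>s'. \<forall>x<N. mem s' ''half'' x = x div 2 \<and> mem s' ''parity'' x = x mod 2)"
    unfolding tables_def
    apply (intro runs_basic)
    apply (rule runs_For[where N = N and Inv = "\<lambda>i s. reg s ''h'' = i div 2 \<and> reg s ''p'' = i mod 2 \<and>
        (\<forall>x<i. mem s ''half'' x = x div 2 \<and> mem s ''parity'' x = x mod 2)"])
           apply (simp_all add: assms)
     apply (intro runs_basic)
      apply (simp_all add: less_Suc_eq parity_step parity_step' disj_imp)
    apply (intro runs_basic)
    apply simp
    done
qed (use assms(3) in blast)

text \<open>Adding \<open>g < M\<close> passes at most one multiple of \<open>M\<close>, so quotient
  and remainder are kept up to date by one comparison and one subtraction.\<close>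

lemma add_mod_div:
  fixes x g M :: nat
  assumes "g < M"
  shows "(x + g) mod M = (if x mod M + g < M then x mod M + g else x mod M + g - M)"
    and "(x + g) div M = (if x mod M + g < M then x div M else x div M + 1)"
proof -
  have "0 < M" using assms by simp
  have "(x + g) mod M = (x mod M + g) mod M" by (simp add: mod_simps)
  moreover have "x mod M + g - M < M"
    using assms mod_less_divisor[OF \<open>0 < M\<close>, of x] by linarith
  then have "(x mod M + g) mod M = (if x mod M + g < M then x mod M + g else x mod M + g - M)"
    by (simp add: le_mod_geq)
  ultimately show 1: "(x + g) mod M = (if x mod M + g < M then x mod M + g else x mod M + g - M)"
    by simp
  have 2: "(x + g) div M * M + (x + g) mod M = x div M * M + x mod M + g" by simp
  have "(x + g) div M * M = (if x mod M + g < M then x div M else x div M + 1) * M"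
  proof (cases "x mod M + g < M")
    case True
    show ?thesis using 2 unfolding 1 if_P[OF True] by linarith
  next
    case False
    show ?thesis using 2 False unfolding 1 if_not_P[OF False] add_mult_distrib mult_1 by linarith
  qed
  then show "(x + g) div M = (if x mod M + g < M then x div M else x div M + 1)"
    using mult_right_cancel[of M "(x + g) div M"] \<open>0 < M\<close> by blast
qed

text \<open>Divides \<open>Q g\<close> by \<open>M\<close> while the product is being summed up:
  \<open>y\<close> is the remainder and \<open>b\<close> the quotient.\<close>

definition multiply_out :: com where
  "multiply_out = block [
     Assign ''y'' (Const 0),
     Assign ''b'' (Const 0),
     For ''i'' ''Q'' (block [
       Assign ''y'' (Add (Var ''y'') (Var ''g'')),
       Cond (Lt (Var ''y'') (Var ''M'')) Skip (block [
         Assign ''y'' (Sub (Var ''y'') (Var ''M'')),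
         Assign ''b'' (Add (Var ''b'') (Const 1))])])]"

lemma runs_multiply_out:
  assumes "reg s ''Q'' = Q" "reg s ''M'' = M" "reg s ''g'' = g" "g < M" "Q \<le> X"
    and "\<And>s'. same_outside multiply_out s s' \<Longrightarrow>
      reg s' ''y'' = Q * g mod M \<Longrightarrow> reg s' ''b'' = Q * g div M \<Longrightarrow> R s'"
  shows "runs X multiply_out s R"
proof (rule runs_conseq)
  have step: "(g + i * g) mod M = (if i * g mod M + g < M then i * g mod M + g else i * g mod M + g - M)"
    "(g + i * g) div M = (if i * g mod M + g < M then i * g div M else i * g div M + 1)" for i
    using add_mod_div[OF assms(4), of "i * g"] by (simp_all add: add.commute)
  show "runs X multiply_out s (\<lambda>s'. reg s' ''y'' = Q * g mod M \<and> reg s' ''b'' = Q * g div M)"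
    unfolding multiply_out_def
    apply (intro runs_basic)
    apply (rule runs_For[where N = Q and
          Inv = "\<lambda>i s. reg s ''y'' = i * g mod M \<and> reg s ''b'' = i * g div M"])
           apply (simp_all add: assms)
     apply (intro runs_basic)
      apply (simp_all add: assms same_outside_reg step)
    apply (intro runs_basic)
    apply simp
    done
qed (use assms(6) in blast)

definition start_labels :: com where
  "start_labels = block [
     Assign ''g'' (Const 0),
     For ''v'' ''n'' (block [
       multiply_out,
       Store ''rest'' (Var ''v'') (Var ''y''),
       Store ''label'' (Var ''v'') (Var ''b''),
       Assign ''g'' (Add (Var ''g'') (Var ''a'')),
       Cond (Lt (Var ''g'') (Var ''M'')) Skip (Assign ''g'' (Sub (Var ''g'') (Var ''M'')))])]"

lemma written_multiply_out [simp]: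
  "written_regs multiply_out = {''y'', ''b'', ''i''}" "written_arrays multiply_out = {}"
  by (auto simp: multiply_out_def)

lemma runs_start_labels:
  assumes "reg s ''n'' = n" "reg s ''Q'' = Q" "reg s ''M'' = M" "reg s ''a'' = a" "a < M"
    and "n \<le> X" "Q \<le> X"
    and "\<And>s'. same_outside start_labels s s' \<Longrightarrow>
      (\<And>v. v < n \<Longrightarrow> mem s' ''rest'' v = Q * (a * v mod M) mod M \<and>
        mem s' ''label'' v = Q * (a * v mod M) div M) \<Longrightarrow> R s'"
  shows "runs X start_labels s R"
proof (rule runs_conseq)
  have "0 < M" using assms(5) by simp
  have step: "(a + a * v) mod M = (if a * v mod M + a < M then a * v mod M + a else a * v mod M + a - M)" for v
    using add_mod_div(1)[OF assms(5), of "a * v"] by (simp_all add: add.commute)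
  show "runs X start_labels s (\<lambda>s'. \<forall>v<n. mem s' ''rest'' v = Q * (a * v mod M) mod M \<and>
        mem s' ''label'' v = Q * (a * v mod M) div M)"
    unfolding start_labels_def
    apply (intro runs_basic)
    apply (rule runs_For[where N = n and Inv = "\<lambda>i s. reg s ''g'' = a * i mod M \<and>
        (\<forall>v<i. mem s ''rest'' v = Q * (a * v mod M) mod M \<and>
          mem s ''label'' v = Q * (a * v mod M) div M)"])
           apply (simp_all add: assms)
     apply (intro runs_basic)
    subgoal for v s'
      apply (rule runs_multiply_out[where Q = Q and M = M and g = "a * v mod M"])
           apply (simp_all add: assms mod_less_divisor[OF \<open>0 < M\<close>] same_outside_reg)
      apply (intro runs_basic)
       apply (simp_all add: assms same_outside_reg same_outside_mem step less_Suc_eq disj_imp)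
      done
    apply (intro runs_basic)
    apply simp
    done
qed (use assms(8) in blast)

definition split_current :: com where
  "split_current =
     For ''v'' ''n'' (Cond
       (Conj (Neg (Lt (Cell ''label'' (Var ''v'')) (Var ''t''))) (Neg (Lt (Var ''t'') (Cell ''label'' (Var ''v'')))))
       (block [
         Assign ''y'' (Add (Cell ''rest'' (Var ''v'')) (Cell ''rest'' (Var ''v''))),
         Cond (Lt (Var ''y'') (Var ''M''))
           (block [Store ''rest'' (Var ''v'') (Var ''y''), Store ''label'' (Var ''v'') (Var ''u'')])
           (block [Store ''rest'' (Var ''v'') (Sub (Var ''y'') (Var ''M'')),
             Store ''label'' (Var ''v'') (Add (Var ''u'') (Const 1))])])
       Skip)"

lemma runs_split_current:
  assumes "reg s ''n'' = n" "reg s ''M'' = M" "reg s ''t'' = t" "reg s ''u'' = u" "n \<le> X"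
    and "\<And>v. v < n \<Longrightarrow> mem s ''rest'' v = r v \<and> mem s ''label'' v = l v"
    and "split_label M True t (r, l, u) = (r', l', u')"
    and "\<And>s'. same_outside split_current s s' \<Longrightarrow>
      (\<And>v. v < n \<Longrightarrow> mem s' ''rest'' v = r' v \<and> mem s' ''label'' v = l' v) \<Longrightarrow> R s'"
  shows "runs X split_current s R"
proof (rule runs_conseq)
  have r': "r' v = (if l v = t then (if 2 * r v < M then 2 * r v else 2 * r v - M) else r v)"
    and l': "l' v = (if l v = t then (if 2 * r v < M then u else u + 1) else l v)" for v
    using assms(7) by (auto simp: split_label_def)
  show "runs X split_current s (\<lambda>s'. \<forall>v<n. mem s' ''rest'' v = r' v \<and> mem s' ''label'' v = l' v)"
    unfolding split_current_def
    apply (rule runs_For[where N = n and Inv = "\<lambda>i s. \<forall>v<n. mem s ''rest'' v = (if v < i then r' v else r v) \<and>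
          mem s ''label'' v = (if v < i then l' v else l v)"])
           apply (simp_all add: assms)
    apply (intro runs_basic)
      apply (auto simp: assms same_outside_reg less_Suc_eq r' l' mult_2)
    done
qed (use assms(8) in blast)

definition split_all :: com where
  "split_all = block [
     Assign ''u'' (Var ''Q''),
     Assign ''x'' (Var ''w''),
     For ''t'' ''L'' (block [
       Cond (Lt (Const 0) (Cell ''parity'' (Var ''x'')))
         (block [split_current, Assign ''u'' (Add (Var ''u'') (Const 2))])
         Skip,
       Assign ''x'' (Cell ''half'' (Var ''x''))])]"

lemma written_split_current [simp]:
  "written_regs split_current = {''v'', ''y''}" "written_arrays split_current = {''rest'', ''label''}"
  by (auto simp: split_current_def)

lemma runs_split_all:
  assumes "reg s ''n'' = n" "reg s ''M'' = M" "reg s ''Q'' = Q" "reg s ''L'' = L" "reg s ''w'' = w"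
    "w < N" "n \<le> X" "L \<le> X"
    and tables: "\<And>x. x < N \<Longrightarrow> mem s ''half'' x = x div 2 \<and> mem s ''parity'' x = x mod 2"
    and "\<And>v. v < n \<Longrightarrow> mem s ''rest'' v = Q * (a * v mod M) mod M \<and>
        mem s ''label'' v = Q * (a * v mod M) div M"
    and "\<And>s'. same_outside split_all s s' \<Longrightarrow>
      (\<And>v. v < n \<Longrightarrow> mem s' ''label'' v = label M Q L a w v) \<Longrightarrow> R s'"
  shows "runs X split_all s R"
proof (rule runs_conseq)
  define \<sigma> where "\<sigma> = split_labels M (\<lambda>t. t \<in> set_decode w) (initial_labeling M Q a)"
  \<comment> \<open>Shifts of \<open>w\<close> stay below \<open>N\<close>, where the tables are
    filled.\<close>
  have less: "w div 2 ^ t < N" for t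
    using assms(6) div_le_dividend[of w "2 ^ t"] by linarith
  have half: "w div 2 ^ t div 2 = w div (2 * 2 ^ t)" for t
    by (simp add: div_mult2_eq[symmetric] mult.commute)
  show "runs X split_all s (\<lambda>s'. \<forall>v<n. mem s' ''label'' v = label M Q L a w v)"
    unfolding split_all_def
  proof (intro runs_basic, rule runs_For[where N = L and Inv = "\<lambda>t s. reg s ''x'' = w div 2 ^ t \<and>
        reg s ''u'' = snd (snd (\<sigma> t)) \<and>
        (\<forall>v<n. mem s ''rest'' v = fst (\<sigma> t) v \<and> mem s ''label'' v = fst (snd (\<sigma> t)) v)"],
      goal_cases)
    \<comment> \<open>Premise 7 of \<open>runs_For\<close> is the loop body, premise 8 the
      exit.\<close>
    case (7 t s')
    obtain r l u where 1: "\<sigma> t = (r, l, u)" by (metis prod_cases3)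
    have x: "reg s' ''x'' = w div 2 ^ t" and u: "reg s' ''u'' = u"
      and rl: "\<And>v. v < n \<Longrightarrow> mem s' ''rest'' v = r v \<and> mem s' ''label'' v = l v"
      using 7(2) 1 by auto
    have bit: "t \<in> set_decode w \<longleftrightarrow> 0 < w div 2 ^ t mod 2"
      by (simp add: set_decode_def odd_iff_mod_2_eq_one)
    show ?case
    proof (intro runs_basic, goal_cases)
      case 1
      obtain r' l' u' where 2: "split_label M True t (r, l, u) = (r', l', u')" by (metis prod_cases3)
      have 3: "\<sigma> (Suc t) = (r', l', u')" "u' = u + 2"
        using 1 2 \<open>\<sigma> t = (r, l, u)\<close> 7(4) less[of t] x
        by (auto simp: \<sigma>_def bit same_outside_mem tables split_label_def)
      show ?case
        apply (rule runs_split_current[where n = n and r = r and l = l, OF _ _ _ _ _ _ 2])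
              apply (use 7 in \<open>simp_all add: assms same_outside_reg u rl\<close>)
        apply (intro runs_basic)
        apply (use 7 3 in \<open>simp add: same_outside_reg same_outside_mem x half tables less u\<close>)
        done
    next
      case 2
      then have "\<sigma> (Suc t) = (r, l, u)"
        using \<open>\<sigma> t = (r, l, u)\<close> 7(4) less[of t] x
        by (auto simp: \<sigma>_def bit same_outside_mem tables split_label_def)
      then show ?case
        using 7 rl by (simp add: same_outside_mem x half tables less u)
    qed
  next
    case (8 s')
    then show ?case by (intro runs_basic) (simp add: \<sigma>_def label_def)
  qed (use assms in \<open>simp_all add: \<sigma>_def initial_labeling_def\<close>)
qed (use assms in blast)

section \<open>The recursion over all sets of labels\<close>

lemma mem_set_decode: "i \<in> set_decode S \<longleftrightarrow> S div 2 ^ i mod 2 = 1"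
  by (simp add: set_decode_def odd_iff_mod_2_eq_one)

definition read_subset :: com where
  "read_subset = block [
     Assign ''x'' (Var ''S''),
     For ''i'' ''D'' (block [
       Store ''member'' (Var ''i'') (Cell ''parity'' (Var ''x'')),
       Assign ''x'' (Cell ''half'' (Var ''x''))])]"

lemma runs_read_subset:
  assumes "reg s ''S'' = S" "reg s ''D'' = D" "D \<le> X" "S < N"
    and tables: "\<And>x. x < N \<Longrightarrow> mem s ''half'' x = x div 2 \<and> mem s ''parity'' x = x mod 2"
    and "\<And>s'. same_outside read_subset s s' \<Longrightarrow>
      (\<And>i. i < D \<Longrightarrow> 0 < mem s' ''member'' i \<longleftrightarrow> i \<in> set_decode S) \<Longrightarrow> R s'"
  shows "runs X read_subset s R"
proof (rule runs_conseq)
  have less: "S div 2 ^ i < N" for i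
    using assms(4) div_le_dividend[of S "2 ^ i"] by linarith
  have half: "S div 2 ^ i div 2 = S div (2 * 2 ^ i)" for i
    by (simp add: div_mult2_eq[symmetric] mult.commute)
  show "runs X read_subset s (\<lambda>s'. \<forall>i<D. 0 < mem s' ''member'' i \<longleftrightarrow> i \<in> set_decode S)"
    unfolding read_subset_def
    apply (intro runs_basic)
    apply (rule runs_For[where N = D and Inv = "\<lambda>i s. reg s ''x'' = S div 2 ^ i \<and>
        (\<forall>j<i. 0 < mem s ''member'' j \<longleftrightarrow> j \<in> set_decode S)"])
           apply (simp_all add: assms)
     apply (intro runs_basic)
     apply (auto simp: same_outside_mem tables less half less_Suc_eq mem_set_decode)[1]
    apply (intro runs_basic)
    apply simp
    done
qed (rule assms(6), simp_all)

definition subset_test :: com where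
  "subset_test = block [
     Assign ''x'' (Var ''S''),
     Assign ''y'' (Var ''T''),
     Assign ''o'' (Const 1),
     For ''i'' ''D'' (block [
       Cond (Lt (Cell ''parity'' (Var ''x'')) (Cell ''parity'' (Var ''y''))) (Assign ''o'' (Const 0)) Skip,
       Assign ''x'' (Cell ''half'' (Var ''x'')),
       Assign ''y'' (Cell ''half'' (Var ''y''))])]"

lemma runs_subset_test:
  assumes "reg s ''S'' = S" "reg s ''T'' = T" "reg s ''D'' = D" "D \<le> X" "S < 2 ^ D" "T < 2 ^ D"
    and tables: "\<And>x. x < 2 ^ D \<Longrightarrow> mem s ''half'' x = x div 2 \<and> mem s ''parity'' x = x mod 2"
    and "\<And>s'. same_outside subset_test s s' \<Longrightarrow>
      0 < reg s' ''o'' \<longleftrightarrow> set_decode T \<subseteq> set_decode S \<Longrightarrow> R s'"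
  shows "runs X subset_test s R"
proof (rule runs_conseq)
  have less: "S div 2 ^ i < 2 ^ D" "T div 2 ^ i < 2 ^ D" for i
    using assms(5,6) div_le_dividend[of S "2 ^ i"] div_le_dividend[of T "2 ^ i"] by linarith+
  have half: "x div 2 ^ i div 2 = x div (2 * 2 ^ i)" for i x :: nat
    by (simp add: div_mult2_eq[symmetric] mult.commute)
  \<comment> \<open>Digits are 0 or 1, so one comparison detects an element of \<open>T\<close>
    outside \<open>S\<close>.\<close>
  have lt: "S div 2 ^ i mod 2 < T div 2 ^ i mod 2 \<longleftrightarrow> i \<in> set_decode T \<and> i \<notin> set_decode S" for i
    unfolding mem_set_decode by linarith
  have sub: "set_decode T \<subseteq> set_decode S \<longleftrightarrow> (\<forall>j<D. j \<in> set_decode T \<longrightarrow> j \<in> set_decode S)"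
    using set_decode_less[OF assms(6)] by blast
  show "runs X subset_test s (\<lambda>s'. 0 < reg s' ''o'' \<longleftrightarrow> set_decode T \<subseteq> set_decode S)"
    unfolding subset_test_def sub
    apply (intro runs_basic)
    apply (rule runs_For[where N = D and Inv = "\<lambda>i s. reg s ''x'' = S div 2 ^ i \<and> reg s ''y'' = T div 2 ^ i \<and>
        (0 < reg s ''o'' \<longleftrightarrow> (\<forall>j<i. j \<in> set_decode T \<longrightarrow> j \<in> set_decode S))"])
           apply (simp_all add: assms)
     apply (intro runs_basic)
      apply (simp_all add: same_outside_mem tables less half lt del: set_decode_Suc)
      apply (auto simp: less_Suc_eq)[2]
    apply (intro runs_basic)
    apply simp
    done
qed (rule assms(8))

text \<open>\<open>q\<close> points at the current edge: it starts at 4, behind the header, and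
  advances by the three words of an edge.\<close>

definition edge_weight :: com where
  "edge_weight = block [
     For ''i'' ''C'' (Store ''count'' (Var ''i'') (Const 0)),
     Assign ''b'' (Const 0),
     Assign ''q'' (Const 4),
     For ''e'' ''m'' (block [
       Cond (Conj
           (Lt (Const 0) (Cell ''member'' (Cell ''label'' (Cell ''in'' (Var ''q'')))))
           (Lt (Const 0) (Cell ''member'' (Cell ''label'' (Cell ''in'' (Add (Var ''q'') (Const 1)))))))
         (block [
           Assign ''z'' (Cell ''in'' (Add (Var ''q'') (Const 2))),
           Store ''count'' (Var ''z'') (Add (Cell ''count'' (Var ''z'')) (Const 1)),
           Cond (Lt (Var ''b'') (Cell ''count'' (Var ''z''))) (Assign ''b'' (Cell ''count'' (Var ''z''))) Skip])
         Skip,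
       Assign ''q'' (Add (Var ''q'') (Const 3))])]"

definition best_partition :: com where
  "best_partition = block [
     Assign ''f'' (Const 0),
     For ''T'' ''N'' (Cond (Lt (Const 0) (Var ''T''))
       (block [
         subset_test,
         Cond (Lt (Const 0) (Var ''o''))
           (block [
             Assign ''z'' (Add (Cell ''weight'' (Var ''T'')) (Cell ''F'' (Sub (Var ''S'') (Var ''T'')))),
             Cond (Lt (Var ''f'') (Var ''z'')) (Assign ''f'' (Var ''z'')) Skip])
           Skip])
       Skip)]"

lemma written_subset_test [simp]:
  "written_regs subset_test = {''x'', ''y'', ''o'', ''i''}" "written_arrays subset_test = {}"
  by (auto simp: subset_test_def)

context edge_list
begin

lemma runs_edge_weight:
  assumes "reg s ''C'' = C" "reg s ''m'' = m" "C \<le> X" "m \<le> X"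
    and bounds: "\<And>e. e < m \<Longrightarrow> ea e < n \<and> eb e < n \<and> ec e < C"
    and input: "\<And>e. e < m \<Longrightarrow> mem s ''in'' (4 + 3 * e) = ea e \<and> mem s ''in'' (5 + 3 * e) = eb e \<and>
      mem s ''in'' (6 + 3 * e) = ec e"
    and lab: "\<And>v. v < n \<Longrightarrow> mem s ''label'' v = lab v \<and> lab v < D"
    and member: "\<And>i. i < D \<Longrightarrow> 0 < mem s ''member'' i \<longleftrightarrow> i \<in> set_decode S"
    and "\<And>s'. same_outside edge_weight s s' \<Longrightarrow> reg s' ''b'' = weight lab S m \<Longrightarrow> R s'"
  shows "runs X edge_weight s R"
proof (rule runs_conseq)
  show "runs X edge_weight s (\<lambda>s'. reg s' ''b'' = weight lab S m)"
    unfolding edge_weight_def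
    apply (intro runs_basic)
    apply (rule runs_For[where N = C and Inv = "\<lambda>i s. \<forall>c<i. mem s ''count'' c = 0"])
           apply (simp_all add: assms)
     apply (intro runs_basic)
     apply (simp add: less_Suc_eq)
    apply (intro runs_basic)
    apply (rule runs_For[where N = m and Inv = "\<lambda>e s. reg s ''q'' = 4 + 3 * e \<and>
        reg s ''b'' = weight lab S e \<and> (\<forall>c<C. mem s ''count'' c = color_count lab S e c)"])
           apply (simp_all add: assms same_outside_reg color_count_def[where e = 0] del: weight.simps(2))
    subgoal for s1 e s2
      using bounds[of e] input[of e] lab[of "ea e"] lab[of "eb e"] member[of "lab (ea e)"]
        member[of "lab (eb e)"]
      apply (intro runs_basic)
         apply (auto simp: same_outside_reg same_outside_mem color_count_Suc inside_def max_def)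
      done
    apply (intro runs_basic)
    apply simp
    done
qed (rule assms(9))

text \<open>Only sets \<open>T\<close> contained in \<open>S\<close> are looked up. They are
  numerically at most \<open>S\<close>, so the weights stored so far suffice.\<close>

lemma runs_best_partition:
  assumes "reg s ''N'' = 2 ^ D" "reg s ''S'' = S" "reg s ''D'' = D" "2 ^ D \<le> X" "D \<le> X" "S < 2 ^ D"
    and tables: "\<And>x. x < 2 ^ D \<Longrightarrow> mem s ''half'' x = x div 2 \<and> mem s ''parity'' x = x mod 2"
    and weight: "\<And>T. T \<le> S \<Longrightarrow> mem s ''weight'' T = weight lab T m"
    and "\<And>s'. same_outside best_partition s s' \<Longrightarrow>
      reg s' ''f'' = best lab (mem s ''F'') S (2 ^ D) \<Longrightarrow> R s'"
  shows "runs X best_partition s R"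
proof (rule runs_conseq)
  show "runs X best_partition s (\<lambda>s'. reg s' ''f'' = best lab (mem s ''F'') S (2 ^ D))"
    unfolding best_partition_def
    apply (intro runs_basic)
    apply (rule runs_For[where N = "2 ^ D" and Inv = "\<lambda>T s'. reg s' ''f'' = best lab (mem s ''F'') S T"])
           apply (simp_all add: assms del: best.simps(2))
     apply (intro runs_basic)
    subgoal for T s1
      apply (rule runs_subset_test[where S = S and T = T and D = D])
             apply (simp_all add: assms same_outside_reg same_outside_mem del: best.simps(2))
      apply (intro runs_basic)
        using set_decode_diff(2)[of T S] weight
        apply (auto simp: same_outside_reg same_outside_mem max_def assms)
      done
     apply simp
    apply (intro runs_basic)
    apply simp
    done
qed (rule assms(9))

end

text \<open>Increasing order ensures that the values needed at \<open>S\<close> are stored.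
  Acceptance is tested at every \<open>S\<close>, in particular at the label set of a separated
  solution.\<close>

definition best_over_subsets :: com where
  "best_over_subsets = For ''S'' ''N'' (block [
     read_subset,
     edge_weight,
     Store ''weight'' (Var ''S'') (Var ''b''),
     best_partition,
     Store ''F'' (Var ''S'') (Var ''f''),
     Cond (Lt (Var ''f'') (Var ''k'')) Skip (Assign ''out'' (Const 1))])"

lemma written_subprograms [simp]:
  "written_regs read_subset = {''x'', ''i''}" "written_arrays read_subset = {''member''}"
  "written_regs edge_weight = {''i'', ''b'', ''q'', ''e'', ''z''}" "written_arrays edge_weight = {''count''}"
  "written_regs best_partition = {''f'', ''T'', ''x'', ''y'', ''o'', ''i'', ''z''}"
  "written_arrays best_partition = {}"
  by (auto simp: read_subset_def edge_weight_def best_partition_def)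

context edge_list
begin

lemma runs_best_over_subsets:
  assumes "reg s ''N'' = 2 ^ D" "reg s ''D'' = D" "reg s ''C'' = C" "reg s ''m'' = m" "reg s ''k'' = k"
    "2 ^ D \<le> X" "D \<le> X" "C \<le> X" "m \<le> X"
    and tables: "\<And>x. x < 2 ^ D \<Longrightarrow> mem s ''half'' x = x div 2 \<and> mem s ''parity'' x = x mod 2"
    and bounds: "\<And>e. e < m \<Longrightarrow> ea e < n \<and> eb e < n \<and> ec e < C"
    and input: "\<And>e. e < m \<Longrightarrow> mem s ''in'' (4 + 3 * e) = ea e \<and> mem s ''in'' (5 + 3 * e) = eb e \<and>
      mem s ''in'' (6 + 3 * e) = ec e"
    and lab: "\<And>v. v < n \<Longrightarrow> mem s ''label'' v = lab v \<and> lab v < D"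
    and final: "\<And>F s'. same_outside best_over_subsets s s' \<Longrightarrow>
      (\<And>S. S < 2 ^ D \<Longrightarrow> F S = best lab F S (2 ^ D)) \<Longrightarrow>
      reg s' ''out'' = (if \<exists>S<2 ^ D. k \<le> F S then 1 else reg s ''out'') \<Longrightarrow> R s'"
  shows "runs X best_over_subsets s R"
proof (rule runs_conseq)
  \<comment> \<open>Only entries below \<open>S\<close> are described: leftovers of earlier
    labelings are overwritten before they are read.\<close>
  define good where "good S s' \<longleftrightarrow>
      (\<forall>T<S. mem s' ''weight'' T = weight lab T m \<and> mem s' ''F'' T = best lab (mem s' ''F'') T (2 ^ D)) \<and>
      reg s' ''out'' = (if \<exists>T<S. k \<le> mem s' ''F'' T then 1 else reg s ''out'')" for S and s' :: state
  show "runs X best_over_subsets s (good (2 ^ D))"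
    unfolding best_over_subsets_def
  proof (rule runs_For[where N = "2 ^ D" and Inv = good], goal_cases)
    case (7 S s1)
    note fr = same_outside_reg[OF 7(4)] same_outside_mem[OF 7(4)]
    show ?case
    proof (intro runs_basic, rule runs_read_subset[where S = S and D = D and N = "2 ^ D"], goal_cases)
      case (6 s2)
      note fr = fr same_outside_reg[OF 6(1)] same_outside_mem[OF 6(1)]
      show ?case
      proof (intro runs_basic, rule runs_edge_weight[where C = C and n = n and lab = lab and D = D and S = S], goal_cases)
        case (9 s3)
        note fr = fr same_outside_reg[OF 9(1)] same_outside_mem[OF 9(1)]
        show ?case
        proof (intro runs_basic, rule runs_best_partition[where D = D and S = S and lab = lab], goal_cases)
          case (8 T)
          then show ?case using 7 9(2) fr by (auto simp: good_def)
        next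
          case (9 s4)
          note fr = fr same_outside_reg[OF 9(1)] same_outside_mem[OF 9(1)]
          have F: "mem s4 ''F'' = mem s1 ''F''" "mem s4 ''weight'' = (mem s1 ''weight'')(S := weight lab S m)"
            "reg s4 ''f'' = best lab (mem s1 ''F'') S (2 ^ D)" "reg s4 ''S'' = S" "reg s4 ''k'' = k"
            "reg s4 ''out'' = reg s1 ''out''"
            using 9(2) 7(3) \<open>reg s3 ''b'' = weight lab S m\<close> by (simp_all add: fr assms(5))
          \<comment> \<open>The table after storing the new entry; up to \<open>S\<close> the
            recursion persists, since it consults smaller arguments only.\<close>
          define G where "G = (mem s1 ''F'')(S := best lab (mem s1 ''F'') S (2 ^ D))"
          have G: "best lab G T (2 ^ D) = best lab (mem s1 ''F'') T (2 ^ D)" if "T \<le> S" for T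
            using that by (intro best_cong) (auto simp: G_def)
          have GT: "G T = best lab G T (2 ^ D)" if "T < Suc S" for T
            using that 7(2) G[of T] by (auto simp: less_Suc_eq good_def) (simp_all add: G_def)
          have out: "(\<exists>T<Suc S. k \<le> G T) \<longleftrightarrow> (\<exists>T<S. k \<le> mem s1 ''F'' T) \<or> k \<le> best lab (mem s1 ''F'') S (2 ^ D)"
            by (auto simp: G_def less_Suc_eq)
          show ?case
            using 7(2) GT out
            by (intro runs_basic) (simp_all add: good_def F G_def[symmetric] less_Suc_eq)
        qed (use 7 in \<open>simp_all add: fr assms\<close>)
      qed (use 7 6 in \<open>simp_all add: fr assms\<close>)
    qed (use 7 in \<open>simp_all add: fr assms\<close>)
  qed (simp_all add: assms good_def)
  fix s' assume "good (2 ^ D) s'" "same_outside best_over_subsets s s'"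
  then show "R s'" by (intro final[where F = "mem s' ''F''"]) (auto simp: good_def)
qed

end

section \<open>Correctness and running time\<close>

definition solver :: com where
  "solver = block [
     parameters,
     tables,
     Assign ''out'' (Const 0),
     For ''a'' ''M'' (For ''w'' ''N'' (block [start_labels, split_all, best_over_subsets]))]"

lemma written_main_subprograms [simp]:
  "written_regs parameters = {''n'', ''C'', ''k'', ''m'', ''Q'', ''L'', ''D'', ''i'', ''N'', ''M''}"
  "written_arrays parameters = {}"
  "written_regs tables = {''h'', ''p'', ''i''}" "written_arrays tables = {''half'', ''parity''}"
  "written_regs start_labels = {''g'', ''v'', ''y'', ''b'', ''i''}"
  "written_arrays start_labels = {''rest'', ''label''}"
  "written_regs split_all = {''u'', ''x'', ''t'', ''v'', ''y''}"
  "written_arrays split_all = {''rest'', ''label''}"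
  "written_regs best_over_subsets =
    {''S'', ''x'', ''i'', ''b'', ''q'', ''e'', ''z'', ''f'', ''T'', ''y'', ''o'', ''out''}"
  "written_arrays best_over_subsets = {''member'', ''count'', ''weight'', ''F''}"
  by (auto simp: parameters_def tables_def start_labels_def split_all_def best_over_subsets_def)

context edge_list
begin

definition solvable :: "nat \<Rightarrow> bool" where
  "solvable k \<longleftrightarrow> (\<exists>T. stable_indices T \<and> k \<le> card T)"

definition separates_solution :: "nat \<Rightarrow> (nat \<Rightarrow> nat) \<Rightarrow> bool" where
  "separates_solution k lab \<longleftrightarrow> (\<exists>T. stable_indices T \<and> k \<le> card T \<and> inj_on lab (ends T))"

lemma ends_less:
  assumes "stable_indices T" "\<And>e. e < m \<Longrightarrow> ea e < n \<and> eb e < n" "v \<in> ends T"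
  shows "v < n"
  using assms by (auto simp: stable_indices_def ends_def)

lemma solvable_separated:
  assumes "solvable k" "\<And>e. e < m \<Longrightarrow> ea e < n \<and> eb e < n"
    and D: "D = 86 * k + 2" and M: "M = (n + 1) * 2 ^ D"
  shows "\<exists>a<M. \<exists>w<2 ^ D. separates_solution k (label M (2 * k) (42 * k) a w)"
proof -
  obtain T' where T': "stable_indices T'" "k \<le> card T'"
    using assms(1) unfolding solvable_def by blast
  \<comment> \<open>Exactly \<open>k\<close> edges are kept, so there are at most \<open>2 k\<close>
    endpoints.\<close>
  obtain T where T: "T \<subseteq> T'" "card T = k" "finite T" using obtain_subset_with_card_n[OF T'(2)] .
  have st: "stable_indices T" using T'(1) T(1) unfolding stable_indices_def by blast
  have "card (ends T) \<le> card (ea ` T) + card (eb ` T)" unfolding ends_def by (rule card_Un_le)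
  also have "\<dots> \<le> 2 * k" using card_image_le[OF T(3), of ea] card_image_le[OF T(3), of eb] T(2) by simp
  finally have "card (ends T) \<le> 2 * k" .
  moreover have "finite (ends T)" using T(3) by (simp add: ends_def)
  moreover have "ends T \<subseteq> {..n}" using ends_less[OF st assms(2)] by (auto intro: less_imp_le)
  ultimately have "\<exists>a<M. \<exists>w<2 ^ D. inj_on (label M (2 * k) (42 * k) a w) (ends T)"
    by (intro separating_label[where n = n]) (simp_all add: M D)
  then show ?thesis using st T(2) unfolding separates_solution_def by blast
qed

lemma runs_solver:
  assumes "mem s ''in'' 0 = n" "mem s ''in'' (Suc 0) = C" "mem s ''in'' 2 = k" "mem s ''in'' 3 = m"
    and bounds: "\<And>e. e < m \<Longrightarrow> ea e < n \<and> eb e < n \<and> ec e < C"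
    and input: "\<And>e. e < m \<Longrightarrow> mem s ''in'' (4 + 3 * e) = ea e \<and> mem s ''in'' (5 + 3 * e) = eb e \<and>
      mem s ''in'' (6 + 3 * e) = ec e"
    and D: "D = 86 * k + 2" and M: "M = (n + 1) * 2 ^ D"
    and X: "C \<le> X" "m \<le> X" "M \<le> X"
  shows "runs X solver s (\<lambda>s'. reg s' ''out'' = (if solvable k then 1 else 0))"
proof -
  have "D < 2 ^ D" by (rule less_exp)
  moreover have "2 ^ D * 1 \<le> 2 ^ D * (n + 1)" "1 * n \<le> 2 ^ D * (n + 1)" by (intro mult_le_mono; simp)+
  ultimately have X': "2 ^ D \<le> X" "D \<le> X" "n \<le> X" "k \<le> X" "2 * k \<le> X" "42 * k \<le> X"
    using X(3) M D by (simp_all add: mult.commute)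
  have "0 < M" by (simp add: M)
  \<comment> \<open>Acceptance is always justified, and every separating choice in \<open>A\<close>
    has led to it.\<close>
  define good where "good A s' \<longleftrightarrow> reg s' ''out'' \<le> 1 \<and> (reg s' ''out'' = 1 \<longrightarrow> solvable k) \<and>
      (\<forall>(a, w)\<in>A. separates_solution k (label M (2 * k) (42 * k) a w) \<longrightarrow> reg s' ''out'' = 1)"
    for A and s' :: state
  \<comment> \<open>The choices tried before word \<open>w\<close> of multiplier \<open>a\<close>,
    in lexicographic order.\<close>
  define before where "before a w = {..<a} \<times> {..<2 ^ D} \<union> {a} \<times> {..<w :: nat}" for a :: nat and w
  have before: "before a (2 ^ D) = before (Suc a) 0" "before a (Suc w) = insert (a, w) (before a w)" for a w :: nat
    by (auto simp: before_def less_Suc_eq)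
  show ?thesis
    unfolding solver_def
  proof (intro runs_basic, rule runs_parameters[where n = n and C = C and k = k and m = m and D = D], goal_cases)
    case (8 s1)
    note s1 = 8(2-9) 8(10)[folded M]
    note fr = same_outside_reg[OF 8(1)] same_outside_mem[OF 8(1)]
    show ?case
    proof (intro runs_basic, rule runs_tables[where N = "2 ^ D"], goal_cases)
      case (3 s2)
      note tab = 3(2)
      note fr = fr same_outside_reg[OF 3(1)] same_outside_mem[OF 3(1)]
      show ?case
      proof (intro runs_basic, rule runs_For[where N = M and Inv = "\<lambda>a. good (before a 0)"], goal_cases)
        case (7 a s3)
        note a = 7(1,2,3)
        note fr = fr same_outside_reg[OF 7(4)] same_outside_mem[OF 7(4)]
        show ?case
        proof (rule runs_For[where N = "2 ^ D" and Inv = "\<lambda>w. good (before a w)"], goal_cases)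
          case (7 w s4)
          note w = 7(1,2,3)
          note fr = fr same_outside_reg[OF 7(4)] same_outside_mem[OF 7(4)]
          show ?case
          proof (intro runs_basic, rule runs_start_labels[where n = n and Q = "2 * k" and M = M and a = a], goal_cases)
            case (8 s5)
            note init = 8(2)
            note fr = fr same_outside_reg[OF 8(1)] same_outside_mem[OF 8(1)]
            show ?case
            proof (intro runs_basic, rule runs_split_all[where n = n and M = M and Q = "2 * k" and L = "42 * k"
                  and w = w and N = "2 ^ D" and a = a], goal_cases)
              case (10 v)
              then show ?case using init by blast
            next
              case (11 s6)
              note fr = fr same_outside_reg[OF 11(1)] same_outside_mem[OF 11(1)]
              let ?lab = "label M (2 * k) (42 * k) a w"
              \<comment> \<open>Labels are at most \<open>2 k + 84 k\<close>, which is less than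
                \<open>D\<close>.\<close>
              have lab: "?lab v < D" for v
                using label_le[OF \<open>0 < M\<close>, of "2 * k" "42 * k" a w v] D by simp
              show ?case
              proof (intro runs_basic, rule runs_best_over_subsets[where D = D and C = C and k = k and n = n
                    and lab = ?lab], goal_cases)
                case (13 v)
                then show ?case using 11(2) lab by blast
              next
                case (14 F s7)
                have sound: "solvable k" if "S < 2 ^ D" "k \<le> F S" for S
                  using best_sound[of "2 ^ D" F ?lab S] 14(2) that unfolding solvable_def
                  by (meson le_trans)
                have complete: "\<exists>S<2 ^ D. k \<le> F S" if sep: "separates_solution k ?lab"
                proof -
                  obtain T where T: "stable_indices T" "k \<le> card T" "inj_on ?lab (ends T)"
                    using sep unfolding separates_solution_def by blast
                  have "\<exists>S<2 ^ D. card T \<le> F S"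
                    using best_complete[of D F ?lab T] 14(2) T lab by blast
                  then show ?thesis using T(2) le_trans by blast
                qed
                have "reg s6 ''out'' = reg s4 ''out''" by (simp add: fr)
                then show ?case
                  using w(2) 14(3) sound complete
                  by (intro runs_basic) (auto simp: good_def before)
              qed (simp_all add: fr s1 tab bounds input X X')
            qed (simp_all add: fr s1 tab w a X')
          qed (simp_all add: fr s1 a X')
        next
          case (8 s4)
          then show ?case by (simp add: good_def before)
        qed (use a(2) in \<open>simp_all add: fr s1 X' good_def\<close>)
      next
        case (8 s3)
        have "reg s3 ''out'' = 1" if sol: "solvable k"
        proof -
          obtain a w where "a < M" "w < 2 ^ D" "separates_solution k (label M (2 * k) (42 * k) a w)"
            using solvable_separated[OF sol _ D M] bounds by blast
          moreover have "(a, w) \<in> before M 0" using calculation by (simp add: before_def)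
          ultimately show ?thesis using 8(1) unfolding good_def by blast
        qed
        then show ?case
          using 8(1) by (intro runs_basic) (auto simp: good_def le_Suc_eq)
      qed (simp_all add: fr s1 X good_def before_def)
    qed (simp_all add: s1 X')
  qed (simp_all add: assms(1-4) D[symmetric, simplified] X')
qed

end

section \<open>From encoded instances to edge indices\<close>

lemma nth_concat_triples:
  assumes "e < length es" "r < 3"
  shows "concat (map (\<lambda>(i, j, c). [i, j, c]) es) ! (3 * e + r)
    = [fst (es ! e), fst (snd (es ! e)), snd (snd (es ! e))] ! r"
  using assms(1)
proof (induction es arbitrary: e)
  case (Cons p es)
  obtain i j c where p: "p = (i, j, c)" by (metis prod_cases3)
  show ?case
  proof (cases e)
    case 0
    then show ?thesis using assms(2) p by (auto simp: less_Suc_eq numeral_3_eq_3)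
  next
    case (Suc e')
    then have "3 * e + r = Suc (Suc (Suc (3 * e' + r)))" by simp
    then show ?thesis using Cons Suc p by (simp only: list.map concat.simps prod.case append.simps nth_Cons_Suc) simp
  qed
qed simp

lemma length_concat_triples: "length (concat (map (\<lambda>(i, j, c). [i, j, c]) es)) = 3 * length es"
  by (induction es) auto

text \<open>Distinctness of the listed vertices, colors and edges makes intersections, colors and
  cardinalities agree with those of indices, so stable sets correspond. The bound on
  \<open>X\<close> covers all loops, the longest count being \<open>M\<close>, the number of colors
  or the number of edges.\<close>

lemma solver_correct:
  assumes enc: "encodes xs V E C l k"
    and X: "2 ^ (86 * k + 2) * (input_size V E C k + 1) \<le> X"
  shows "decides_within solver xs (colored_clustering E l k) (steps X solver)"
proof -
  obtain vs cs es where vs: "distinct vs" "set vs = V" and cs: "distinct cs" "set cs = C"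
    and es: "\<forall>(i, j, c) \<in> set es. i < length vs \<and> j < length vs \<and> c < length cs \<and>
        l {vs ! i, vs ! j} = cs ! c"
    and dist: "distinct (map (\<lambda>(i, j, c). {vs ! i, vs ! j}) es)"
    and E: "set (map (\<lambda>(i, j, c). {vs ! i, vs ! j}) es) = E"
    and xs: "xs = [length vs, length cs, k, length es] @ concat (map (\<lambda>(i, j, c). [i, j, c]) es)"
    using enc unfolding encodes_def by blast
  define ea eb ec where "ea e = fst (es ! e)" and "eb e = fst (snd (es ! e))"
    and "ec e = snd (snd (es ! e))" for e
  define edge where "edge e = {vs ! ea e, vs ! eb e}" for e
  let ?m = "length es"
  interpret edge_list ?m ea eb ec .
  have bounds: "ea e < length vs \<and> eb e < length vs \<and> ec e < length cs \<and> l (edge e) = cs ! ec e"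
    if "e < ?m" for e
    using es nth_mem[OF that] by (auto simp: ea_def eb_def ec_def edge_def case_prod_beta)
  have edge: "map (\<lambda>(i, j, c). {vs ! i, vs ! j}) es = map edge [0..<?m]"
    by (rule nth_equalityI) (simp_all add: edge_def ea_def eb_def case_prod_beta)
  have inj: "inj_on edge {..<?m}"
    using dist unfolding edge by (simp add: distinct_map atLeast0LessThan)
  have img: "edge ` {..<?m} = E"
    using E unfolding edge by (simp add: atLeast0LessThan)
  have meet: "edge e \<inter> edge e' \<noteq> {} \<longleftrightarrow> {ea e, eb e} \<inter> {ea e', eb e'} \<noteq> {}"
    if "e < ?m" "e' < ?m" for e e'
    using bounds[OF that(1)] bounds[OF that(2)] vs(1) by (auto simp: edge_def nth_eq_iff_index_eq)
  have color: "l (edge e) = l (edge e') \<longleftrightarrow> ec e = ec e'" if "e < ?m" "e' < ?m" for e e'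
    using bounds[OF that(1)] bounds[OF that(2)] cs(1) by (auto simp: nth_eq_iff_index_eq)
  have stable_iff: "stable l (edge ` T) \<longleftrightarrow> stable_indices T" if "T \<subseteq> {..<?m}" for T
  proof -
    have iff: "(edge e \<inter> edge e' \<noteq> {} \<longrightarrow> l (edge e) = l (edge e')) \<longleftrightarrow>
        ({ea e, eb e} \<inter> {ea e', eb e'} \<noteq> {} \<longrightarrow> ec e = ec e')" if "e \<in> T" "e' \<in> T" for e e'
    proof -
      have "e < ?m" "e' < ?m" using that \<open>T \<subseteq> {..<?m}\<close> by auto
      show ?thesis unfolding meet[OF \<open>e < ?m\<close> \<open>e' < ?m\<close>] color[OF \<open>e < ?m\<close> \<open>e' < ?m\<close>] by (rule refl)
    qed
    have "stable l (edge ` T) \<longleftrightarrow>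
        (\<forall>e\<in>T. \<forall>e'\<in>T. edge e \<inter> edge e' \<noteq> {} \<longrightarrow> l (edge e) = l (edge e'))"
      unfolding stable_def by blast
    also have "\<dots> \<longleftrightarrow> (\<forall>e\<in>T. \<forall>e'\<in>T. {ea e, eb e} \<inter> {ea e', eb e'} \<noteq> {} \<longrightarrow> ec e = ec e')"
      by (intro ball_cong refl iff)
    also have "\<dots> \<longleftrightarrow> stable_indices T" unfolding stable_indices_def using that by blast
    finally show ?thesis .
  qed
  have card: "card (edge ` T) = card T" if "T \<subseteq> {..<?m}" for T
    using that inj by (meson card_image inj_on_subset)
  have solv: "solvable k \<longleftrightarrow> colored_clustering E l k"
  proof
    assume "solvable k"
    then obtain T where T: "stable_indices T" "k \<le> card T" by (auto simp: solvable_def)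
    then have "T \<subseteq> {..<?m}" by (simp add: stable_indices_def)
    then show "colored_clustering E l k"
      using T stable_iff card img unfolding colored_clustering_def by (metis image_mono)
  next
    assume "colored_clustering E l k"
    then obtain F where F: "F \<subseteq> E" "stable l F" "k \<le> card F" by (auto simp: colored_clustering_def)
    then obtain T where "T \<subseteq> {..<?m}" "F = edge ` T" using img by (metis subset_image_iff)
    then show "solvable k" using F stable_iff card unfolding solvable_def by metis
  qed
  have size: "length vs + length cs + ?m \<le> input_size V E C k"
    using distinct_card[OF vs(1)] distinct_card[OF cs(1)] card_image[OF inj] vs(2) cs(2) img
    by (simp add: input_size_def)
  define D where "D = 86 * k + 2"
  have big: "2 ^ D * x \<le> X" "x \<le> X" if "x \<le> length vs + length cs + ?m + 1" for x
  proof -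
    have "x \<le> input_size V E C k + 1" using that size by linarith
    then have "2 ^ D * x \<le> 2 ^ D * (input_size V E C k + 1)" by (rule mult_le_mono2)
    also have "\<dots> \<le> X" using X by (simp only: D_def)
    finally show "2 ^ D * x \<le> X" .
    moreover have "1 * x \<le> 2 ^ D * x" by (rule mult_le_mono1) simp
    ultimately show "x \<le> X" by linarith
  qed
  have X': "length cs \<le> X" "?m \<le> X" by (rule big, simp)+
  have M: "(length vs + 1) * 2 ^ D \<le> X" using big(1)[of "length vs + 1"] by (simp add: mult.commute)
  have inp: "mem (initial_state xs) ''in'' i = xs ! i" if "i < 4 + 3 * ?m" for i
    using that by (simp add: initial_state_def xs length_concat_triples)
  have header: "xs ! 0 = length vs" "xs ! Suc 0 = length cs" "xs ! 2 = k" "xs ! 3 = ?m"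
    by (simp_all add: xs)
  have input: "mem (initial_state xs) ''in'' (4 + 3 * e + r) = [ea e, eb e, ec e] ! r"
    if "e < ?m" "r < 3" for e r
  proof -
    have "xs ! (4 + 3 * e + r) = concat (map (\<lambda>(i, j, c). [i, j, c]) es) ! (3 * e + r)"
      by (simp add: xs nth_append)
    then show ?thesis
      using that inp[of "4 + 3 * e + r"] nth_concat_triples[OF that]
      by (simp add: ea_def eb_def ec_def)
  qed
  have "runs X solver (initial_state xs) (\<lambda>s'. reg s' ''out'' = (if solvable k then 1 else 0))"
  proof (rule runs_solver[where n = "length vs" and C = "length cs" and D = D and M = "(length vs + 1) * 2 ^ D"])
    fix e assume "e < ?m"
    then show "mem (initial_state xs) ''in'' (4 + 3 * e) = ea e \<and>
        mem (initial_state xs) ''in'' (5 + 3 * e) = eb e \<and> mem (initial_state xs) ''in'' (6 + 3 * e) = ec e"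
      using input[of e 0] input[of e 1] input[of e 2] by (simp add: ac_simps)
  qed (use bounds X' M in \<open>simp_all add: inp header D_def\<close>)
  then show ?thesis unfolding decides_within_def runs_def solv .
qed

theorem theorem1:
  shows "\<exists>(P :: com) (g :: nat \<Rightarrow> nat) (q :: nat poly).
    (\<lambda>k. real (g k)) \<in> O(\<lambda>k. real k) \<and>
    (\<forall>(V :: nat set) (E :: nat set set) (C :: nat set) (l :: nat set \<Rightarrow> nat) (k :: nat) xs.
      simple_graph V E \<longrightarrow> edge_coloring E C l \<longrightarrow> encodes xs V E C l k \<longrightarrow>
      decides_within P xs (colored_clustering E l k)
        (2 ^ g k * poly q (input_size V E C k)))"
proof -
  obtain p :: "nat poly" where p: "\<And>X. steps X solver = poly p X" using steps_poly by blast
  \<comment> \<open>The exponential factor \<open>2 ^ (86 k + 2)\<close> of the loop bound is raised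
    to the degree of the time bound.\<close>
  define g where "g k = (86 * k + 2) * degree p" for k
  \<comment> \<open>The shift accounts for the factor \<open>input_size V E C k + 1\<close>.\<close>
  define q where "q = pcompose p [:1, 1:]"
  have "(\<lambda>k. real (g k)) \<in> O(\<lambda>k. real k)"
  proof (rule bigoI)
    show "\<forall>\<^sub>F k in at_top. norm (real (g k)) \<le> (88 * real (degree p)) * norm (real k)"
      using eventually_ge_at_top[of 1]
    proof eventually_elim
      case (elim k)
      \<comment> \<open>Since \<open>k \<ge> 1\<close>, the summand 2 is at most
        \<open>2 k\<close>.\<close>
      then have "g k \<le> 88 * k * degree p" unfolding g_def by (intro mult_le_mono1) simp
      then have "real (g k) \<le> real (88 * k * degree p)" by (simp only: of_nat_le_iff)
      then show ?case by (simp add: mult_ac)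
    qed
  qed
  moreover have "decides_within solver xs (colored_clustering E l k) (2 ^ g k * poly q (input_size V E C k))"
    if "encodes xs V E C l k" for V E C k xs and l :: "nat set \<Rightarrow> nat"
  proof -
    let ?u = "2 ^ (86 * k + 2) :: nat" and ?v = "input_size V E C k + 1"
    have "steps (?u * ?v) solver \<le> ?u ^ degree p * poly p ?v" unfolding p by (rule poly_mult_le) simp
    also have "\<dots> = 2 ^ g k * poly q (input_size V E C k)"
      unfolding g_def q_def power_mult poly_pcompose by (simp add: add.commute)
    finally show ?thesis
      using solver_correct[OF that order.refl] unfolding decides_within_def by (meson le_trans)
  qed
  ultimately show ?thesis by blast
qed

end
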